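(* Let $p\in\{1,\infty\}$ and let $E$ be a locally convex space. The following are equivalent: (i) every $(p,\infty)$-limited subset of $E$ is precompact; (ii) for every bounded non-precompact set $B\subseteq E$ there is a weak$^*$ $p$-summable sequence $(\chi_n)$ in $E'$ with $\|\chi_n\|_B\not\to0$; (iii) for every infinite bounded separated subset $D$ of $E$ and every $\delta>0$ there exist a sequence $(x_n)$ in $D$ and a weak$^*$ $p$-summable sequence $(f_n)$ in $E'$ such that $|f_n(x_k)|<\delta$ and $|f_n(x_n)|>1+\delta$ for all $k<n$; (iv) for every infinite bounded separated set $D\subseteq E$ there is a continuous linear operator $T$ from $E$ into $\ell_1$ (if $p=1$), resp. into $c_0$ (if $p=\infty$), where the target carries the topology of coordinatewise convergence induced from $\mathbb F^\omega$, such that $T(D)$ is not precompact in the Banach space $\ell_1$ (resp. $c_0$).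
   Context: Locally convex spaces are Hausdorff over $\mathbb F\in\{\mathbb R,\mathbb C\}$. For $A\subseteq E$ and $\chi\in E'$, $\|\chi\|_A:=\sup\{|\chi(x)|:x\in A\cup\{0\}\}$. A sequence $(\chi_n)$ in $E'$ is weak$^*$ $p$-summable if $(\chi_n(x))_n\in\ell_p$ for every $x\in E$ (in $c_0$ if $p=\infty$). A nonempty $A\subseteq E$ is $(p,\infty)$-limited if $\|\chi_n\|_A\to0$ for every weak$^*$ $p$-summable sequence $(\chi_n)$ in $E'$. A set $D\subseteq E$ is separated if there is a neighbourhood $U$ of zero with $a-a'\notin U$ for all distinct $a,a'\in D$. *)

theory Defs
  imports "HOL-Analysis.Analysis" "HOL-Library.Function_Algebras"
begin

definition is_field_iso :: "('k::real_normed_field \<Rightarrow> 'l::real_normed_field) \<Rightarrow> bool" where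
  "is_field_iso \<phi> \<longleftrightarrow> bij \<phi> \<and> (\<forall>x y. \<phi> (x + y) = \<phi> x + \<phi> y \<and> \<phi> (x * y) = \<phi> x * \<phi> y)
      \<and> (\<forall>x. norm (\<phi> x) = norm x)"

definition real_or_complex :: "'k::real_normed_field itself \<Rightarrow> bool" where
  "real_or_complex _ \<longleftrightarrow>
     (\<exists>\<phi> :: 'k \<Rightarrow> real. is_field_iso \<phi>) \<or> (\<exists>\<phi> :: 'k \<Rightarrow> complex. is_field_iso \<phi>)"

text \<open>Locally convex (Hausdorff) space: a vector space with a separating family of seminorms
  generating the topology.\<close>
definition lc_seminorm :: "('k::real_normed_field \<Rightarrow> 'a::ab_group_add \<Rightarrow> 'a) \<Rightarrow> ('a \<Rightarrow> real) \<Rightarrow> bool" where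
  "lc_seminorm sc q \<longleftrightarrow> (\<forall>x y. q (x + y) \<le> q x + q y) \<and> (\<forall>c x. q (sc c x) = norm c * q x)"

definition lcs :: "('k::real_normed_field \<Rightarrow> 'a::ab_group_add \<Rightarrow> 'a) \<Rightarrow> ('a \<Rightarrow> real) set \<Rightarrow> bool" where
  "lcs sc Ps \<longleftrightarrow> vector_space sc \<and> (\<forall>q\<in>Ps. lc_seminorm sc q)
     \<and> (\<forall>x. x \<noteq> 0 \<longrightarrow> (\<exists>q\<in>Ps. q x \<noteq> 0))"

definition zero_nhd :: "('a::ab_group_add \<Rightarrow> real) set \<Rightarrow> 'a set \<Rightarrow> bool" where
  "zero_nhd Ps U \<longleftrightarrow> (\<exists>F \<epsilon>. finite F \<and> F \<subseteq> Ps \<and> \<epsilon> > 0 \<and> {x. \<forall>q\<in>F. q x < \<epsilon>} \<subseteq> U)"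

definition lc_precompact :: "('a::ab_group_add \<Rightarrow> real) set \<Rightarrow> 'a set \<Rightarrow> bool" where
  "lc_precompact Ps A \<longleftrightarrow>
     (\<forall>U. zero_nhd Ps U \<longrightarrow> (\<exists>K. finite K \<and> A \<subseteq> (\<Union>k\<in>K. (\<lambda>u. k + u) ` U)))"

definition lc_bounded :: "('a::ab_group_add \<Rightarrow> real) set \<Rightarrow> 'a set \<Rightarrow> bool" where
  "lc_bounded Ps B \<longleftrightarrow> (\<forall>q\<in>Ps. bdd_above (q ` B))"

definition separated :: "('a::ab_group_add \<Rightarrow> real) set \<Rightarrow> 'a set \<Rightarrow> bool" where
  "separated Ps D \<longleftrightarrow> (\<exists>U. zero_nhd Ps U \<and> (\<forall>a\<in>D. \<forall>a'\<in>D. a \<noteq> a' \<longrightarrow> a - a' \<notin> U))"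

definition lc_continuous :: "('a::ab_group_add \<Rightarrow> real) set \<Rightarrow> ('a \<Rightarrow> 'm::metric_space) \<Rightarrow> bool" where
  "lc_continuous Ps f \<longleftrightarrow>
     (\<forall>x. \<forall>\<epsilon>>0. \<exists>U. zero_nhd Ps U \<and> (\<forall>u\<in>U. dist (f (x + u)) (f x) < \<epsilon>))"

definition lc_dual :: "('k::real_normed_field \<Rightarrow> 'a::ab_group_add \<Rightarrow> 'a) \<Rightarrow> ('a \<Rightarrow> real) set \<Rightarrow> ('a \<Rightarrow> 'k) set" where
  "lc_dual sc Ps = {\<psi>. Vector_Spaces.linear sc (*) \<psi> \<and> lc_continuous Ps \<psi>}"

definition weak_star_summable ::
  "('k::real_normed_field \<Rightarrow> 'a::ab_group_add \<Rightarrow> 'a) \<Rightarrow> ('a \<Rightarrow> real) set \<Rightarrow> ereal \<Rightarrow> (nat \<Rightarrow> 'a \<Rightarrow> 'k) \<Rightarrow> bool" where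
  "weak_star_summable sc Ps p \<psi> \<longleftrightarrow> (\<forall>n. \<psi> n \<in> lc_dual sc Ps) \<and>
     (\<forall>x. if p = \<infinity> then (\<lambda>n. \<psi> n x) \<longlonglongrightarrow> 0 else summable (\<lambda>n. norm (\<psi> n x)))"

definition sup_on :: "('a::zero \<Rightarrow> 'k::real_normed_field) \<Rightarrow> 'a set \<Rightarrow> ereal" where
  "sup_on \<psi> A = (SUP x\<in>insert 0 A. ereal (norm (\<psi> x)))"

definition p_infty_limited ::
  "('k::real_normed_field \<Rightarrow> 'a::ab_group_add \<Rightarrow> 'a) \<Rightarrow> ('a \<Rightarrow> real) set \<Rightarrow> ereal \<Rightarrow> 'a set \<Rightarrow> bool" where
  "p_infty_limited sc Ps p A \<longleftrightarrow> A \<noteq> {} \<and>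
     (\<forall>\<psi>. weak_star_summable sc Ps p \<psi> \<longrightarrow> (\<lambda>n. sup_on (\<psi> n) A) \<longlonglongrightarrow> 0)"

definition in_l1 :: "(nat \<Rightarrow> 'k::real_normed_field) \<Rightarrow> bool" where
  "in_l1 y \<longleftrightarrow> summable (\<lambda>i. norm (y i))"

definition l1_norm :: "(nat \<Rightarrow> 'k::real_normed_field) \<Rightarrow> real" where
  "l1_norm y = (\<Sum>i. norm (y i))"

definition in_c0 :: "(nat \<Rightarrow> 'k::real_normed_field) \<Rightarrow> bool" where
  "in_c0 y \<longleftrightarrow> y \<longlonglongrightarrow> 0"

definition sup_norm :: "(nat \<Rightarrow> 'k::real_normed_field) \<Rightarrow> real" where
  "sup_norm y = (SUP i. norm (y i))"

definition norm_precompact :: "((nat \<Rightarrow> 'k::real_normed_field) \<Rightarrow> real) \<Rightarrow> (nat \<Rightarrow> 'k) set \<Rightarrow> bool" where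
  "norm_precompact N S \<longleftrightarrow>
     (\<forall>\<epsilon>>0. \<exists>K. finite K \<and> K \<subseteq> S \<and> S \<subseteq> (\<Union>k\<in>K. {y. N (y - k) < \<epsilon>}))"

text \<open>Continuous linear operators E \<rightarrow> l1 (p = 1) resp. E \<rightarrow> c0 (p = \<infinity>), the target carrying
  the topology of coordinatewise convergence (subspace of F^\<omega>): continuity into a product
  topology means continuity of every coordinate.\<close>
definition coord_operator ::
  "('k::real_normed_field \<Rightarrow> 'a::ab_group_add \<Rightarrow> 'a) \<Rightarrow> ('a \<Rightarrow> real) set \<Rightarrow> ereal \<Rightarrow> ('a \<Rightarrow> nat \<Rightarrow> 'k) \<Rightarrow> bool" where
  "coord_operator sc Ps p T \<longleftrightarrow>
     Vector_Spaces.linear sc (\<lambda>c y i. c * y i) T \<and> (\<forall>i. lc_continuous Ps (\<lambda>x. T x i)) \<and>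
     (\<forall>x. if p = \<infinity> then in_c0 (T x) else in_l1 (T x))"

end

theory Submission
  imports Defs
begin

text \<open>
  The four conditions are proved in a cycle. A limited set is bounded: if a seminorm \<open>q\<close> exceeds
  \<open>2^n\<close> at \<open>x_n\<close>, the functionals \<open>2^(-n) f_n\<close>, where \<open>f_n\<close> is dominated by \<open>q\<close> and norms \<open>x_n\<close>
  (Hahn-Banach), are weak* 1-summable but large at \<open>x_n\<close>. From (ii) to (iii), a weak*
  summable sequence is pointwise null, so a subsequence can be chosen greedily; its members are
  the coordinates of the operator in (iv). Finally, an operator as in (iv) maps a limited set to a
  set with uniformly small tails: for \<open>c_0\<close> this is limitedness applied to the coordinates, and for
  \<open>\<ell>_1\<close> it follows from a gliding hump argument. Uniformly small tails and bounded coordinates make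
  the image precompact.
\<close>

lemma exists_sequence_avoiding_history:
  assumes "\<And>K. finite K \<Longrightarrow> \<exists>x. P x \<and> (\<forall>k\<in>K. R k x)"
  obtains x :: "nat \<Rightarrow> 'b" where "\<And>n. P (x n)" "\<And>k n. k < n \<Longrightarrow> R (x k) (x n)"
proof -
  have "\<exists>x. \<forall>n::nat. P (x n) \<and> (\<forall>k<n. R (x k) (x n))"
  proof (rule dependent_wellorder_choice)
    fix n and f :: "nat \<Rightarrow> 'b"
    show "\<exists>r. P r \<and> (\<forall>k<n. R (f k) r)"
      using assms[of "f ` {..<n}"] by auto
  qed auto
  with that show thesis by blast
qed

subsection \<open>The Hahn-Banach theorem for seminorms\<close>

text \<open>The scalar action is an argument because the real structure will be obtained by
  restricting the scalars of the given space.\<close>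

definition sublinear :: "(real \<Rightarrow> 'a::ab_group_add \<Rightarrow> 'a) \<Rightarrow> ('a \<Rightarrow> real) \<Rightarrow> bool" where
  "sublinear s h \<longleftrightarrow> (\<forall>x y. h (x + y) \<le> h x + h y) \<and> (\<forall>r>0. \<forall>x. h (s r x) = r * h x)"

context
  fixes s :: "real \<Rightarrow> 'a::ab_group_add \<Rightarrow> 'a"
  assumes vs: "vector_space s"
begin

interpretation vector_space s by (fact vs)

lemma sublinear_zero: "h 0 = 0" if "sublinear s h"
proof -
  have "h (s 2 0) = 2 * h 0" using that unfolding sublinear_def by (meson zero_less_numeral)
  then show ?thesis by simp
qed

lemma sublinear_lower: "- h (- x) \<le> h x" if "sublinear s h"
proof -
  have "h (x + - x) \<le> h x + h (- x)" using that unfolding sublinear_def by blast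
  then show ?thesis using sublinear_zero[OF that] by simp
qed

text \<open>A minimal sublinear functional cannot be lowered in this way, and is therefore additive.\<close>
lemma sublinear_ray_improvement:
  assumes h: "sublinear s h"
  obtains h' where "sublinear s h'" "\<And>x. h' x \<le> h x" "\<And>x. h' x \<le> h (x + y) - h y"
proof -
  \<comment> \<open>Taking the infimum over the whole ray keeps \<open>h'\<close> positively
    homogeneous, since \<open>t\<close> can be rescaled; the values \<open>t = 0\<close> and
    \<open>t = 1\<close> give the two upper bounds.\<close>
  define h' where "h' x = (INF t\<in>{0..}. h (x + s t y) - t * h y)" for x
  have add: "h (x + z) \<le> h x + h z" for x z using h unfolding sublinear_def by blast
  have hom: "h (s r x) = r * h x" if "r \<ge> 0" for r x
    using h sublinear_zero[OF h] that unfolding sublinear_def by (cases "r = 0") auto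
  have bdd: "bdd_below ((\<lambda>t. h (x + s t y) - t * h y) ` {0..})" for x
  proof (rule bdd_belowI2)
    fix t :: real assume "t \<in> {0..}"
    then show "- h (- x) \<le> h (x + s t y) - t * h y"
      using add[of "x + s t y" "- x"] hom[of t y] by simp
  qed
  have le: "h' x \<le> h (x + s t y) - t * h y" if "t \<ge> 0" for x t
    unfolding h'_def using that by (intro cINF_lower bdd) auto
  have greatest: "c \<le> h' x" if "\<And>t. t \<ge> 0 \<Longrightarrow> c \<le> h (x + s t y) - t * h y" for c x
    unfolding h'_def using that by (intro cINF_greatest) auto
  have "sublinear s h'"
    unfolding sublinear_def
  proof (intro conjI allI impI)
    fix x z
    \<comment> \<open>The two infima are split off one at a time. The parameters \<open>t\<close>
      and \<open>u\<close> for the summands merge into the admissible parameter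
      \<open>t + u\<close>.\<close>
    have "h' (x + z) - (h (z + s u y) - u * h y) \<le> h' x" if "u \<ge> 0" for u
    proof (rule greatest)
      fix t :: real assume "t \<ge> 0"
      with that have "h' (x + z) \<le> h ((x + z) + s (t + u) y) - (t + u) * h y" by (intro le) auto
      also have "(x + z) + s (t + u) y = (x + s t y) + (z + s u y)"
        by (simp add: scale_left_distrib algebra_simps)
      also have "h \<dots> \<le> h (x + s t y) + h (z + s u y)" by (rule add)
      finally show "h' (x + z) - (h (z + s u y) - u * h y) \<le> h (x + s t y) - t * h y"
        by (simp add: algebra_simps)
    qed
    then have "h' (x + z) - h' x \<le> h' z" by (intro greatest) (simp add: algebra_simps)
    then show "h' (x + z) \<le> h' x + h' z" by simp
  next
    have ge: "h' (s r x) \<le> r * h' x" if "r > 0" for r x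
    proof -
      have "h' (s r x) / r \<le> h' x"
      proof (rule greatest)
        fix t :: real assume "t \<ge> 0"
        with that have "h' (s r x) \<le> h (s r x + s (r * t) y) - (r * t) * h y" by (intro le) auto
        also have "s r x + s (r * t) y = s r (x + s t y)" by (simp add: scale_right_distrib)
        also have "h (s r (x + s t y)) - r * t * h y = (h (x + s t y) - t * h y) * r"
          using that hom[of r "x + s t y"] by (simp add: left_diff_distrib right_diff_distrib mult_ac)
        finally show "h' (s r x) / r \<le> h (x + s t y) - t * h y"
          using that by (simp add: pos_divide_le_eq)
      qed
      then show ?thesis using that by (simp add: field_simps)
    qed
    fix r :: real and x assume r: "r > 0"
    then have "h' (s (1 / r) (s r x)) \<le> (1 / r) * h' (s r x)" by (intro ge) auto
    with r have "r * h' x \<le> h' (s r x)" by (simp add: field_simps)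
    with ge[OF r, of x] show "h' (s r x) = r * h' x" by simp
  qed
  moreover have "h' x \<le> h x" for x using le[of 0 x] by simp
  moreover have "h' x \<le> h (x + y) - h y" for x using le[of 1 x] by simp
  ultimately show thesis using that by blast
qed

text \<open>Zorn's lemma. The pointwise infimum of a chain stays finite because a sublinear
  functional below \<open>q\<close> satisfies \<open>- q (- x) \<le> h x\<close>.\<close>

lemma exists_minimal_sublinear:
  assumes q: "sublinear s q"
  obtains h where "sublinear s h" "\<And>x. h x \<le> q x"
    "\<And>h'. sublinear s h' \<Longrightarrow> (\<And>x. h' x \<le> h x) \<Longrightarrow> h' = h"
proof -
  define A where "A = {h. sublinear s h \<and> (\<forall>x. h x \<le> q x)}"
  \<comment> \<open>The order is reversed, so that the maximal element delivered by Zorn is minimal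
    pointwise.\<close>
  have "\<exists>m\<in>A. \<forall>a\<in>A. (\<lambda>f g. g \<le> f) m a \<longrightarrow> a = m"
  proof (rule predicate_Zorn)
    show "partial_order_on A (relation_of (\<lambda>f g. g \<le> f) A)"
      by (rule partial_order_on_relation_ofI) auto
  next
    fix C assume "C \<in> Chains (relation_of (\<lambda>f g. g \<le> f) A)"
    then have CA: "C \<subseteq> A" and total: "\<And>f g. f \<in> C \<Longrightarrow> g \<in> C \<Longrightarrow> f \<le> g \<or> g \<le> f"
      unfolding Chains_def relation_of_def by blast+
    show "\<exists>u\<in>A. \<forall>a\<in>C. u \<le> a"
    proof (cases "C = {}")
      case True
      then show ?thesis using q unfolding A_def by auto
    next
      case False
      define m where "m x = (INF h\<in>C. h x)" for x
      have bdd: "bdd_below ((\<lambda>h. h x) ` C)" for x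
      proof (rule bdd_belowI2)
        fix h assume "h \<in> C"
        with CA have h: "sublinear s h" "h (- x) \<le> q (- x)" unfolding A_def by auto
        then show "- q (- x) \<le> h x" using sublinear_lower[of h x] by linarith
      qed
      have le: "m x \<le> h x" if "h \<in> C" for h x
        unfolding m_def using that by (intro cINF_lower bdd) auto
      have greatest: "c \<le> m x" if "\<And>h. h \<in> C \<Longrightarrow> c \<le> h x" for c x
        unfolding m_def using that False by (intro cINF_greatest) auto
      have "sublinear s m"
        unfolding sublinear_def
      proof (intro conjI allI impI)
        fix x z
        have "m (x + z) - k z \<le> m x" if k: "k \<in> C" for k
        proof (rule greatest)
          fix h assume h: "h \<in> C"
          \<comment> \<open>Subadditivity holds for one functional at a time, so \<open>h\<close>
            and \<open>k\<close> are replaced by the smaller of the two, which lies in the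
            chain.\<close>
          obtain l where l: "l \<in> C" "l \<le> h" "l \<le> k" using total[OF h k] h k by blast
          have "m (x + z) \<le> l (x + z)" using l by (intro le)
          also have "\<dots> \<le> l x + l z" using l CA unfolding A_def sublinear_def by blast
          also have "\<dots> \<le> h x + k z" using l by (intro add_mono) (auto simp: le_fun_def)
          finally show "m (x + z) - k z \<le> h x" by simp
        qed
        then have "m (x + z) - m x \<le> m z" by (intro greatest) (simp add: algebra_simps)
        then show "m (x + z) \<le> m x + m z" by simp
      next
        fix r :: real and x assume r: "r > 0"
        have hom: "h (s r x) = r * h x" if "h \<in> C" for h
          using that CA r unfolding A_def sublinear_def by blast
        have "m (s r x) / r \<le> m x"
          using le[of _ "s r x"] hom r by (intro greatest) (simp add: field_simps)
        moreover have "r * m x \<le> m (s r x)"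
        proof (rule greatest)
          fix h assume "h \<in> C"
          with le[of h x] hom[of h] r show "r * m x \<le> h (s r x)" by simp
        qed
        ultimately show "m (s r x) = r * m x" using r by (simp add: field_simps)
      qed
      moreover have "m x \<le> q x" for x
        using False CA le unfolding A_def by (metis (mono_tags, lifting) all_not_in_conv mem_Collect_eq order_trans subsetD)
      ultimately show ?thesis using le unfolding A_def by (intro bexI[of _ m]) (auto simp: le_fun_def)
    qed
  qed
  then obtain m where "m \<in> A" "\<And>a. a \<in> A \<Longrightarrow> a \<le> m \<Longrightarrow> a = m" by blast
  then show thesis
    by (intro that[of m]) (auto simp: A_def le_fun_def intro: order_trans)
qed

text \<open>The ray improvement is used twice: along \<open>x0\<close> before minimising, to force
  the value at \<open>x0\<close>, and along each \<open>y\<close> at the minimal functional, where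
  it can change nothing and so yields additivity.\<close>

lemma real_hahn_banach:
  assumes q: "sublinear s q"
  obtains g where "\<And>x y. g (x + y) = g x + g y" "\<And>r x. g (s r x) = r * g x"
    "\<And>x. g x \<le> q x" "g x0 = q x0"
proof -
  obtain q' where q': "sublinear s q'" "\<And>x. q' x \<le> q x" "\<And>x. q' x \<le> q (x + x0) - q x0"
    using sublinear_ray_improvement[OF q] by blast
  obtain g where g: "sublinear s g" "\<And>x. g x \<le> q' x"
    and min: "\<And>h. sublinear s h \<Longrightarrow> (\<And>x. h x \<le> g x) \<Longrightarrow> h = g"
    using exists_minimal_sublinear[OF q'(1)] by blast
  have add: "g (x + y) = g x + g y" for x y
  proof -
    obtain h where h: "sublinear s h" "\<And>x. h x \<le> g x" "\<And>x. h x \<le> g (x + y) - g y"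
      using sublinear_ray_improvement[OF g(1)] by blast
    have "h = g" using h by (intro min)
    with h(3)[of x] have "g x + g y \<le> g (x + y)" by simp
    then show ?thesis using g(1) unfolding sublinear_def by (meson order_antisym)
  qed
  have zero: "g 0 = 0" by (rule sublinear_zero[OF g(1)])
  have minus: "g (- x) = - g x" for x using add[of x "- x"] zero by simp
  have pos: "g (s r x) = r * g x" if "r > 0" for r x
    using g(1) that unfolding sublinear_def by blast
  have hom: "g (s r x) = r * g x" for r x
  proof (cases "r > 0 \<or> r = 0")
    case True
    then show ?thesis using pos zero by auto
  next
    case False
    then have "g (s (- r) x) = - r * g x" by (intro pos) auto
    then show ?thesis using minus[of "s r x"] by simp
  qed
  have le: "g x \<le> q x" for x using g(2) q'(2) order_trans by blast
  \<comment> \<open>At \<open>- x0\<close> the improved bound reads \<open>q 0 - q x0\<close>; by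
    oddness of \<open>g\<close> this is the missing inequality
    \<open>q x0 \<le> g x0\<close>.\<close>
  have "g (- x0) \<le> - q x0"
    using g(2)[of "- x0"] q'(3)[of "- x0"] sublinear_zero[OF q] by simp
  then have "g x0 = q x0" using minus[of x0] le[of x0] by simp
  with add hom le show thesis using that by blast
qed

end

section \<open>Seminorms, change of scalars and Hahn-Banach over the given field\<close>

lemma lc_seminorm_zero: 
  assumes "vector_space sc" "lc_seminorm sc q" shows "q 0 = 0"
proof -
  interpret vector_space sc by fact
  have "q (sc 0 0) = norm (0::'a) * q 0" using assms(2) unfolding lc_seminorm_def by blast
  then show ?thesis by simp
qed

lemma lc_seminorm_minus:
  assumes "vector_space sc" "lc_seminorm sc q" shows "q (- x) = q x"
proof -
  interpret vector_space sc by fact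
  have "q (sc (- 1) x) = norm (- 1::'a) * q x" using assms(2) unfolding lc_seminorm_def by blast
  then show ?thesis by simp
qed

lemma lc_seminorm_nonneg:
  assumes "vector_space sc" "lc_seminorm sc q" shows "0 \<le> q x"
proof -
  have "q (x + - x) \<le> q x + q (- x)" using assms(2) unfolding lc_seminorm_def by blast
  then show ?thesis using lc_seminorm_zero[OF assms] lc_seminorm_minus[OF assms] by simp
qed

lemma is_field_iso_inverse:
  fixes \<phi> :: "'k::real_normed_field \<Rightarrow> 'l::real_normed_field"
  assumes "is_field_iso \<phi>"
  obtains \<sigma> :: "'l \<Rightarrow> 'k" where "surj \<sigma>" "\<And>x y. \<sigma> (x + y) = \<sigma> x + \<sigma> y" "\<And>x y. \<sigma> (x * y) = \<sigma> x * \<sigma> y"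
    "\<sigma> 0 = 0" "\<sigma> 1 = 1" "\<And>x. norm (\<sigma> x) = norm x"
proof -
  have bij: "bij \<phi>" and add: "\<And>x y. \<phi> (x + y) = \<phi> x + \<phi> y"
    and mult: "\<And>x y. \<phi> (x * y) = \<phi> x * \<phi> y" and norm: "\<And>x. norm (\<phi> x) = norm x"
    using assms unfolding is_field_iso_def by auto
  define \<sigma> where "\<sigma> = inv \<phi>"
  have \<phi>\<sigma>: "\<phi> (\<sigma> y) = y" for y unfolding \<sigma>_def using bij by (simp add: bij_is_surj surj_f_inv_f)
  have \<sigma>\<phi>: "\<sigma> (\<phi> x) = x" for x unfolding \<sigma>_def using bij by (simp add: bij_is_inj)
  have a: "\<sigma> (x + y) = \<sigma> x + \<sigma> y" for x y using \<sigma>\<phi>[of "\<sigma> x + \<sigma> y"] by (simp add: add \<phi>\<sigma>)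
  have m: "\<sigma> (x * y) = \<sigma> x * \<sigma> y" for x y using \<sigma>\<phi>[of "\<sigma> x * \<sigma> y"] by (simp add: mult \<phi>\<sigma>)
  have z: "\<sigma> 0 = 0" using a[of 0 0] by simp
  have n: "norm (\<sigma> x) = norm x" for x using norm[of "\<sigma> x"] \<phi>\<sigma> by simp
  \<comment> \<open>Multiplicativity makes \<open>\<sigma> 1\<close> idempotent, and a nonzero
    idempotent of a field is 1.\<close>
  have "\<sigma> 1 \<noteq> 0" using n[of 1] by auto
  then have "\<sigma> 1 = 1" using m[of 1 1] by simp
  with a m z n that[of \<sigma>] show thesis using \<sigma>\<phi> by (metis surjI)
qed

text \<open>Restriction of scalars along a unital ring homomorphism; it turns the space into a real
  one, to which the real theorem applies.\<close>

lemma vector_space_pullback: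
  fixes sc :: "'k::field \<Rightarrow> 'a::ab_group_add \<Rightarrow> 'a" and \<sigma> :: "'l::field \<Rightarrow> 'k"
  assumes "vector_space sc" "\<And>x y. \<sigma> (x + y) = \<sigma> x + \<sigma> y" "\<And>x y. \<sigma> (x * y) = \<sigma> x * \<sigma> y" "\<sigma> 1 = 1"
  shows "vector_space (\<lambda>r. sc (\<sigma> r))"
proof -
  interpret vector_space sc by fact
  show ?thesis
    by unfold_locales (auto simp: assms scale_left_distrib scale_right_distrib)
qed

lemma vector_space_times: "vector_space ((*) :: 'k::field \<Rightarrow> 'k \<Rightarrow> 'k)"
  by unfold_locales (auto simp: algebra_simps)

text \<open>The field is known only up to isometric isomorphism, so real or complex scalars are
  transported through \<open>\<sigma>\<close>. In the complex case a real functional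
  \<open>g\<close> is complexified.\<close>

lemma hahn_banach_seminorm:
  fixes sc :: "'k::real_normed_field \<Rightarrow> 'a::ab_group_add \<Rightarrow> 'a"
  assumes K: "real_or_complex TYPE('k)" and vs: "vector_space sc" and q: "lc_seminorm sc q"
  obtains f where "Vector_Spaces.linear sc (*) f" "\<And>x. norm (f x) \<le> q x" "norm (f x0) = q x0"
proof -
  interpret vector_space sc by (fact vs)
  have q_scale: "q (sc c x) = norm c * q x" for c x using q unfolding lc_seminorm_def by blast
  have q_minus: "q (- x) = q x" for x by (rule lc_seminorm_minus[OF vs q])
  have q_nonneg: "0 \<le> q x" for x by (rule lc_seminorm_nonneg[OF vs q])
  have linI: "Vector_Spaces.linear sc (*) f"
    if "\<And>x y. f (x + y) = f x + f y" "\<And>c x. f (sc c x) = c * f x" for f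
    using that vs vector_space_times
    unfolding Vector_Spaces.linear_iff by blast
  consider (real) \<phi> :: "'k \<Rightarrow> real" where "is_field_iso \<phi>"
    | (complex) \<phi> :: "'k \<Rightarrow> complex" where "is_field_iso \<phi>"
    using K unfolding real_or_complex_def by blast
  then show thesis
  proof cases
    case real
    obtain \<sigma> :: "real \<Rightarrow> 'k" where \<sigma>: "surj \<sigma>" "\<And>x y. \<sigma> (x + y) = \<sigma> x + \<sigma> y"
      "\<And>x y. \<sigma> (x * y) = \<sigma> x * \<sigma> y" "\<sigma> 0 = 0" "\<sigma> 1 = 1" "\<And>x. norm (\<sigma> x) = norm x"
      by (rule is_field_iso_inverse[OF real]) blast
    have vs': "vector_space (\<lambda>r. sc (\<sigma> r))" by (rule vector_space_pullback[OF vs \<sigma>(2,3,5)])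
    have "sublinear (\<lambda>r. sc (\<sigma> r)) q"
      using q unfolding sublinear_def lc_seminorm_def by (simp add: \<sigma>)
    then obtain g where g: "\<And>x y. g (x + y) = g x + g y" "\<And>r x. g (sc (\<sigma> r) x) = r * g x"
      "\<And>x. g x \<le> q x" "g x0 = q x0"
      by (rule real_hahn_banach[OF vs']) blast
    have "g 0 = 0" using g(1)[of 0 0] by simp
    then have gm: "g (- x) = - g x" for x using g(1)[of x "- x"] by simp
    show thesis
    proof (rule that[of "\<lambda>x. \<sigma> (g x)"])
      show "Vector_Spaces.linear sc (*) (\<lambda>x. \<sigma> (g x))"
      proof (rule linI)
        fix c x
        obtain r where "c = \<sigma> r" using \<sigma>(1) by (rule surjE)
        then show "\<sigma> (g (sc c x)) = c * \<sigma> (g x)" by (simp add: g \<sigma>)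
      qed (simp add: g \<sigma>)
      \<comment> \<open>The one-sided bound at \<open>x\<close> and at \<open>- x\<close> bounds the
        absolute value, as \<open>q\<close> is even.\<close>
      show "norm (\<sigma> (g x)) \<le> q x" for x
        using g(3)[of x] g(3)[of "- x"] gm[of x] q_minus[of x] by (simp add: \<sigma>)
      show "norm (\<sigma> (g x0)) = q x0" using q_nonneg[of x0] by (simp add: \<sigma> g)
    qed
  next
    case complex
    obtain \<sigma> :: "complex \<Rightarrow> 'k" where \<sigma>: "surj \<sigma>" "\<And>x y. \<sigma> (x + y) = \<sigma> x + \<sigma> y"
      "\<And>x y. \<sigma> (x * y) = \<sigma> x * \<sigma> y" "\<sigma> 0 = 0" "\<sigma> 1 = 1" "\<And>x. norm (\<sigma> x) = norm x"
      by (rule is_field_iso_inverse[OF complex]) blast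
    have vs': "vector_space (\<lambda>r. sc (\<sigma> (complex_of_real r)))"
      by (rule vector_space_pullback[OF vs]) (simp_all add: \<sigma>)
    have "sublinear (\<lambda>r. sc (\<sigma> (complex_of_real r))) q"
      using q unfolding sublinear_def lc_seminorm_def by (simp add: \<sigma>)
    then obtain g where g: "\<And>x y. g (x + y) = g x + g y"
      "\<And>r x. g (sc (\<sigma> (complex_of_real r)) x) = r * g x"
      "\<And>x. g x \<le> q x" "g x0 = q x0"
      by (rule real_hahn_banach[OF vs']) blast
    \<comment> \<open>The classical complexification g(x) - i g(ix), whose real part is
      \<open>g\<close>.\<close>
    define h where "h x = Complex (g x) (- g (sc (\<sigma> \<i>) x))" for x
    have h_scale: "h (sc (\<sigma> z) x) = z * h x" for z x
    proof -
      have g_scale: "g (sc (\<sigma> w) x) = Re w * g x + Im w * g (sc (\<sigma> \<i>) x)" for w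
      proof -
        have "sc (\<sigma> w) x = sc (\<sigma> (complex_of_real (Re w) + complex_of_real (Im w) * \<i>)) x"
          by (rule arg_cong[where f = "\<lambda>c. sc (\<sigma> c) x"]) (simp add: complex_eq_iff)
        also have "\<dots> = sc (\<sigma> (Re w)) x + sc (\<sigma> (Im w)) (sc (\<sigma> \<i>) x)"
          by (simp add: \<sigma> scale_left_distrib)
        finally show ?thesis by (simp only: g)
      qed
      show ?thesis
        using g_scale[of z] g_scale[of "\<i> * z"] unfolding h_def
        by (simp add: \<sigma> complex_eq_iff)
    qed
    have h_le: "norm (h x) \<le> q x" for x
    proof -
      \<comment> \<open>Multiplying by the conjugate phase makes \<open>h\<close> real and
        nonnegative, where it agrees with \<open>g\<close> and inherits its bound. If
        \<open>h x = 0\<close> then \<open>w = 0\<close>, which is harmless.\<close>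
      define w where "w = cnj (sgn (h x))"
      have w: "norm w \<le> 1" unfolding w_def by (simp add: norm_sgn)
      have "w * h x = complex_of_real (norm (h x))"
        using complex_norm_square[of "h x"] unfolding w_def
        by (cases "h x = 0") (simp_all add: sgn_eq power2_eq_square field_simps)
      then have "norm (h x) = g (sc (\<sigma> w) x)"
        using h_scale[of w x] by (simp add: h_def complex_eq_iff)
      also have "\<dots> \<le> norm w * q x" using g(3)[of "sc (\<sigma> w) x"] by (simp add: q_scale \<sigma>)
      also have "\<dots> \<le> q x" using w q_nonneg[of x] by (simp add: mult_left_le_one_le)
      finally show ?thesis .
    qed
    show thesis
    proof (rule that[of "\<lambda>x. \<sigma> (h x)"])
      show "Vector_Spaces.linear sc (*) (\<lambda>x. \<sigma> (h x))"
      proof (rule linI)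
        fix c x
        obtain r where "c = \<sigma> r" using \<sigma>(1) by (rule surjE)
        then show "\<sigma> (h (sc c x)) = c * \<sigma> (h x)" by (simp add: h_scale \<sigma>)
      next
        fix x y
        have "h (x + y) = h x + h y" by (simp add: h_def g scale_right_distrib complex_eq_iff)
        then show "\<sigma> (h (x + y)) = \<sigma> (h x) + \<sigma> (h y)" by (simp add: \<sigma>)
      qed
      show "norm (\<sigma> (h x)) \<le> q x" for x using h_le by (simp add: \<sigma>)
      have "q x0 \<le> norm (h x0)" using abs_Re_le_cmod[of "h x0"] by (simp add: h_def g)
      with h_le[of x0] show "norm (\<sigma> (h x0)) = q x0" by (simp add: \<sigma>)
    qed
  qed
qed

subsection \<open>Precompactness in sequence spaces\<close>

text \<open>This trades the extended real supremum for uniform smallness on \<open>A\<close>. The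
  point 0 adjoined in \<open>sup_on\<close> contributes nothing because each \<open>\<psi> n\<close>
  vanishes there.\<close>

lemma sup_on_tendsto_zero_iff:
  assumes "\<And>n. \<psi> n 0 = 0"
  shows "(\<lambda>n. sup_on (\<psi> n) A) \<longlonglongrightarrow> 0 \<longleftrightarrow> (\<forall>\<epsilon>>0. \<forall>\<^sub>F n in sequentially. \<forall>x\<in>A. norm (\<psi> n x) < \<epsilon>)"
proof
  assume lim: "(\<lambda>n. sup_on (\<psi> n) A) \<longlonglongrightarrow> 0"
  show "\<forall>\<epsilon>>0. \<forall>\<^sub>F n in sequentially. \<forall>x\<in>A. norm (\<psi> n x) < \<epsilon>"
  proof (intro allI impI)
    fix \<epsilon> :: real assume "\<epsilon> > 0"
    then have "\<forall>\<^sub>F n in sequentially. sup_on (\<psi> n) A < ereal \<epsilon>"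
      using lim by (intro order_tendstoD) auto
    then show "\<forall>\<^sub>F n in sequentially. \<forall>x\<in>A. norm (\<psi> n x) < \<epsilon>"
    proof eventually_elim
      case (elim n)
      have "ereal (norm (\<psi> n x)) \<le> sup_on (\<psi> n) A" if "x \<in> A" for x
        unfolding sup_on_def using that by (intro SUP_upper) auto
      with elim show ?case by (metis ereal_less_eq(3) less_le_not_le not_less order_trans)
    qed
  qed
next
  assume small: "\<forall>\<epsilon>>0. \<forall>\<^sub>F n in sequentially. \<forall>x\<in>A. norm (\<psi> n x) < \<epsilon>"
  have nonneg: "0 \<le> sup_on (\<psi> n) A" for n
    unfolding sup_on_def by (rule SUP_upper2[of 0]) (auto simp: assms)
  show "(\<lambda>n. sup_on (\<psi> n) A) \<longlonglongrightarrow> 0"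
  proof (rule order_tendstoI)
    fix a :: ereal assume "a < 0"
    then show "\<forall>\<^sub>F n in sequentially. a < sup_on (\<psi> n) A"
      using nonneg by (intro always_eventually allI) (rule less_le_trans)
  next
    fix a :: ereal assume "0 < a"
    then obtain e where e: "0 < ereal e" "ereal e < a" using ereal_dense2 by blast
    then have "\<forall>\<^sub>F n in sequentially. \<forall>x\<in>A. norm (\<psi> n x) < e" using small by simp
    then show "\<forall>\<^sub>F n in sequentially. sup_on (\<psi> n) A < a"
    proof eventually_elim
      case (elim n)
      have "sup_on (\<psi> n) A \<le> ereal e"
        unfolding sup_on_def using elim e(1) by (intro SUP_least) (auto simp: assms)
      with e(2) show ?case by simp
    qed
  qed
qed

text \<open>Total boundedness of balls of the scalar field, phrased through a square grid in the
  complex plane: a colour is a grid cell.\<close>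

lemma exists_finite_colouring:
  assumes "real_or_complex TYPE('k::real_normed_field)" "\<eta> > 0"
  obtains \<kappa> :: "'k::real_normed_field \<Rightarrow> int \<times> int"
    where "\<And>a b. \<kappa> a = \<kappa> b \<Longrightarrow> norm (a - b) < \<eta>" "\<And>M. finite (\<kappa> ` {a. norm a \<le> M})"
proof -
  \<comment> \<open>An additive isometry into the complex numbers is all that the grid requires, so
    the real and complex cases can be merged here.\<close>
  obtain \<rho> :: "'k \<Rightarrow> complex" where \<rho>: "\<And>x y. \<rho> (x + y) = \<rho> x + \<rho> y" "\<And>x. norm (\<rho> x) = norm x"
  proof -
    consider (real) \<phi> :: "'k \<Rightarrow> real" where "is_field_iso \<phi>"
      | (complex) \<phi> :: "'k \<Rightarrow> complex" where "is_field_iso \<phi>"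
      using assms(1) unfolding real_or_complex_def by blast
    then show thesis
    proof cases
      case real
      then show thesis
        by (intro that[of "\<lambda>x. complex_of_real (\<phi> x)"]) (auto simp: is_field_iso_def)
    next
      case complex
      then show thesis by (intro that[of \<phi>]) (auto simp: is_field_iso_def)
    qed
  qed
  have diff: "\<rho> (a - b) = \<rho> a - \<rho> b" for a b using \<rho>(1)[of "a - b" b] by simp
  \<comment> \<open>Cells have side \<open>\<eta> / 2\<close>, since the modulus is bounded by the
    sum of the absolute real and imaginary parts.\<close>
  define \<kappa> where "\<kappa> a = (\<lfloor>2 * Re (\<rho> a) / \<eta>\<rfloor>, \<lfloor>2 * Im (\<rho> a) / \<eta>\<rfloor>)" for a
  have floor: "\<bar>s - t\<bar> < \<eta> / 2" if "\<lfloor>2 * s / \<eta>\<rfloor> = \<lfloor>2 * t / \<eta>\<rfloor>" for s t :: real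
  proof -
    have "\<bar>2 * s / \<eta> - 2 * t / \<eta>\<bar> < 1" using that by linarith
    also have "2 * s / \<eta> - 2 * t / \<eta> = 2 / \<eta> * (s - t)"
      by (simp add: right_diff_distrib diff_divide_distrib)
    finally have "2 / \<eta> * \<bar>s - t\<bar> < 1" using assms(2) by (simp only: abs_mult) simp
    then show ?thesis using assms(2) by (simp add: field_simps)
  qed
  show thesis
  proof (rule that[of \<kappa>])
    fix a b assume "\<kappa> a = \<kappa> b"
    then have "\<bar>Re (\<rho> (a - b))\<bar> < \<eta> / 2" "\<bar>Im (\<rho> (a - b))\<bar> < \<eta> / 2"
      using floor[of "Re (\<rho> a)" "Re (\<rho> b)"] floor[of "Im (\<rho> a)" "Im (\<rho> b)"]
      by (simp_all add: \<kappa>_def diff)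
    then show "norm (a - b) < \<eta>" using cmod_le[of "\<rho> (a - b)"] \<rho>(2)[of "a - b"] by linarith
  next
    fix M
    define L where "L = \<lceil>2 * M / \<eta>\<rceil>"
    have range: "\<lfloor>2 * t / \<eta>\<rfloor> \<in> {- L - 1..L}" if "\<bar>t\<bar> \<le> M" for t
    proof -
      have "\<bar>2 * t / \<eta>\<bar> \<le> 2 * M / \<eta>"
        using that assms(2) by (simp add: abs_divide divide_right_mono)
      then show ?thesis unfolding L_def atLeastAtMost_iff by linarith
    qed
    have "\<kappa> ` {a. norm a \<le> M} \<subseteq> {- L - 1..L} \<times> {- L - 1..L}"
    proof clarify
      fix a i j assume a: "norm a \<le> M" "(i, j) = \<kappa> a"
      have "\<bar>Re (\<rho> a)\<bar> \<le> M" "\<bar>Im (\<rho> a)\<bar> \<le> M"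
        using a(1) abs_Re_le_cmod[of "\<rho> a"] abs_Im_le_cmod[of "\<rho> a"] \<rho>(2)[of a] by auto
      then have "\<lfloor>2 * Re (\<rho> a) / \<eta>\<rfloor> \<in> {- L - 1..L}" "\<lfloor>2 * Im (\<rho> a) / \<eta>\<rfloor> \<in> {- L - 1..L}"
        using range by blast+
      then show "i \<in> {- L - 1..L} \<and> j \<in> {- L - 1..L}" using a(2) by (simp add: \<kappa>_def)
    qed
    then show "finite (\<kappa> ` {a. norm a \<le> M})" by (rule finite_subset) simp
  qed
qed

text \<open>Points whose first \<open>m\<close> coordinates have equal colours are close, and
  boundedness of each coordinate leaves only finitely many colour lists.\<close>

lemma norm_precompactI:
  fixes S :: "(nat \<Rightarrow> 'k::real_normed_field) set"
  assumes K: "real_or_complex TYPE('k)"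
    and bounded: "\<And>i. \<exists>M. \<forall>y\<in>S. norm (y i) \<le> M"
    and close: "\<And>\<epsilon>. \<epsilon> > 0 \<Longrightarrow> \<exists>m \<eta>. \<eta> > 0 \<and>
      (\<forall>y\<in>S. \<forall>z\<in>S. (\<forall>i<m. norm (y i - z i) < \<eta>) \<longrightarrow> N (y - z) < \<epsilon>)"
  shows "norm_precompact N S"
  unfolding norm_precompact_def
proof (intro allI impI)
  fix \<epsilon> :: real assume "\<epsilon> > 0"
  then obtain m :: nat and \<eta> where \<eta>: "\<eta> > 0"
    and c: "\<And>y z. y \<in> S \<Longrightarrow> z \<in> S \<Longrightarrow> (\<forall>i<m. norm (y i - z i) < \<eta>) \<Longrightarrow> N (y - z) < \<epsilon>"
    using close by metis
  obtain \<kappa> :: "'k \<Rightarrow> int \<times> int" where \<kappa>: "\<And>a b. \<kappa> a = \<kappa> b \<Longrightarrow> norm (a - b) < \<eta>"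
    and fin: "\<And>M. finite (\<kappa> ` {a. norm a \<le> M})"
    by (rule exists_finite_colouring[OF K \<eta>]) blast
  obtain M where M: "\<And>i y. y \<in> S \<Longrightarrow> norm (y i) \<le> M i" using bounded by metis
  define colour where "colour y = map (\<lambda>i. \<kappa> (y i)) [0..<m]" for y :: "nat \<Rightarrow> 'k"
  define B where "B = (\<Union>i<m. \<kappa> ` {a. norm a \<le> M i})"
  have "colour ` S \<subseteq> {l. set l \<subseteq> B \<and> length l = m}"
    unfolding colour_def B_def using M by fastforce
  moreover have "finite {l. set l \<subseteq> B \<and> length l = m}"
    unfolding B_def using fin by (intro finite_lists_length_eq) auto
  ultimately have "finite (colour ` S)" by (rule finite_subset)
  \<comment> \<open>One representative per colour list, picked inside \<open>S\<close> because
    \<open>norm_precompact\<close> requires centres in the set.\<close>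
  then obtain K where K: "K \<subseteq> S" "finite K" "colour ` S = colour ` K"
    using finite_subset_image[of "colour ` S" colour S] by blast
  have "y \<in> (\<Union>k\<in>K. {y. N (y - k) < \<epsilon>})" if y: "y \<in> S" for y
  proof -
    have "colour y \<in> colour ` K" using K(3) y by blast
    then obtain k where k: "k \<in> K" "colour y = colour k" by blast
    then have "\<forall>i<m. \<kappa> (y i) = \<kappa> (k i)" unfolding colour_def by simp
    with \<kappa> have "N (y - k) < \<epsilon>" using y k K(1) by (intro c) auto
    with k show ?thesis by blast
  qed
  with K show "\<exists>K. finite K \<and> K \<subseteq> S \<and> S \<subseteq> (\<Union>k\<in>K. {y. N (y - k) < \<epsilon>})" by blast
qed

text \<open>Convergence makes the range bounded, without which the real supremum gives no upper
  bound.\<close>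

lemma norm_coordinate_le_sup_norm:
  assumes "in_c0 y" shows "norm (y i) \<le> sup_norm y"
proof -
  have "Bseq y" using assms unfolding in_c0_def by (intro convergent_imp_Bseq convergentI)
  then have "bdd_above (range (\<lambda>i. norm (y i)))" unfolding Bseq_def by (auto intro: bdd_aboveI2)
  then show ?thesis unfolding sup_norm_def by (intro cSUP_upper) auto
qed

lemma norm_coordinate_le_l1_norm:
  assumes "in_l1 y" shows "norm (y i) \<le> l1_norm y"
  using assms sum_le_suminf[of "\<lambda>i. norm (y i)" "{i}"] unfolding in_l1_def l1_norm_def by simp

lemma sup_norm_le:
  assumes "\<And>i. norm (y i) \<le> c" shows "sup_norm y \<le> c"
  unfolding sup_norm_def using assms by (intro cSUP_least) auto

lemma l1_norm_diff_le:
  assumes "in_l1 y" "in_l1 z"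
  shows "l1_norm (y - z) \<le>
    (\<Sum>i<m. norm (y i - z i)) + (\<Sum>i. norm (y (i + m))) + (\<Sum>i. norm (z (i + m)))"
proof -
  have y: "summable (\<lambda>i. norm (y i))" and z: "summable (\<lambda>i. norm (z i))"
    using assms unfolding in_l1_def by auto
  have tails: "summable (\<lambda>i. norm (y (i + m)) + norm (z (i + m)))"
    using y z by (intro summable_add summable_ignore_initial_segment)
  have diff: "summable (\<lambda>i. norm (y i - z i))"
    by (rule summable_comparison_test'[OF summable_add[OF y z], of 0])
      (simp add: norm_triangle_ineq4)
  have "l1_norm (y - z) = (\<Sum>i. norm (y (i + m) - z (i + m))) + (\<Sum>i<m. norm (y i - z i))"
    unfolding l1_norm_def using suminf_split_initial_segment[OF diff, of m] by simp
  also have "(\<Sum>i. norm (y (i + m) - z (i + m))) \<le> (\<Sum>i. norm (y (i + m)) + norm (z (i + m)))"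
    using diff tails
    by (intro suminf_le norm_triangle_ineq4) (auto intro: summable_ignore_initial_segment[of "\<lambda>i. norm (y i - z i)"])
  also have "\<dots> = (\<Sum>i. norm (y (i + m))) + (\<Sum>i. norm (z (i + m)))"
    using y z by (intro suminf_add[symmetric] summable_ignore_initial_segment)
  finally show ?thesis by (simp only: add_ac)
qed

text \<open>Finitely many disjoint blocks form one finite set of indices, whose sum is below the
  total. Singleton blocks handle subsequences, intervals handle the gliding hump.\<close>

lemma summable_block_sums:
  fixes f :: "nat \<Rightarrow> real" and I :: "nat \<Rightarrow> nat set"
  assumes f: "summable f" "\<And>n. 0 \<le> f n" and I: "\<And>k. finite (I k)" "disjoint_family I"
  shows "summable (\<lambda>k. \<Sum>n\<in>I k. f n)"
proof (rule summableI_nonneg_bounded)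
  fix m
  have "(\<Sum>k<m. \<Sum>n\<in>I k. f n) = (\<Sum>n\<in>(\<Union>k<m. I k). f n)"
    using I by (intro sum.UNION_disjoint[symmetric]) (auto simp: disjoint_family_on_def)
  also have "\<dots> \<le> suminf f" using f I by (intro sum_le_suminf) auto
  finally show "(\<Sum>k<m. \<Sum>n\<in>I k. f n) \<le> suminf f" .
qed (use f in \<open>auto intro: sum_nonneg\<close>)

subsection \<open>Functionals and limited sets in locally convex spaces\<close>

context
  fixes sc :: "'k::real_normed_field \<Rightarrow> 'a::ab_group_add \<Rightarrow> 'a"
    and Ps :: "('a \<Rightarrow> real) set"
  assumes lcs: "lcs sc Ps"
begin

lemma lcs_vector_space: "vector_space sc"
  using lcs unfolding lcs_def by blast

lemma lcs_seminorm: "q \<in> Ps \<Longrightarrow> lc_seminorm sc q"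
  using lcs unfolding lcs_def by blast

lemma lcs_nonneg: "q \<in> Ps \<Longrightarrow> 0 \<le> q x"
  using lc_seminorm_nonneg lcs_vector_space lcs_seminorm by blast

lemma lcs_scale: "q \<in> Ps \<Longrightarrow> q (sc c x) = norm c * q x"
  using lcs_seminorm unfolding lc_seminorm_def by blast

lemma lcs_minus: "q \<in> Ps \<Longrightarrow> q (- x) = q x"
  using lc_seminorm_minus lcs_vector_space lcs_seminorm by blast

lemma lcs_zero: "q \<in> Ps \<Longrightarrow> q 0 = 0"
  using lc_seminorm_zero lcs_vector_space lcs_seminorm by blast

lemma lcs_diff: "q \<in> Ps \<Longrightarrow> q (x - y) \<le> q x + q y"
  using lcs_seminorm[of q] lcs_minus[of q y] unfolding lc_seminorm_def
  by (metis diff_conv_add_uminus)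

section \<open>Continuous linear functionals\<close>

lemma linear_functional_iff:
  "Vector_Spaces.linear sc (*) f \<longleftrightarrow> (\<forall>x y. f (x + y) = f x + f y) \<and> (\<forall>c x. f (sc c x) = c * f x)"
  using lcs_vector_space vector_space_times unfolding Vector_Spaces.linear_iff by blast

lemma lc_dual_linearD:
  assumes "\<psi> \<in> lc_dual sc Ps"
  shows "\<psi> (x + y) = \<psi> x + \<psi> y" "\<psi> (sc c x) = c * \<psi> x" "\<psi> 0 = 0" "\<psi> (x - y) = \<psi> x - \<psi> y"
proof -
  show *: "\<psi> (x + y) = \<psi> x + \<psi> y" "\<psi> (sc c x) = c * \<psi> x" for x y c
    using assms unfolding lc_dual_def linear_functional_iff by auto
  show "\<psi> 0 = 0" using *(1)[of 0 0] by simp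
  show "\<psi> (x - y) = \<psi> x - \<psi> y" using *(1)[of "x - y" y] by simp
qed

text \<open>With \<open>lc_dual_bound\<close>, this replaces continuity by domination by finitely
  many seminorms, which passes easily to linear combinations.\<close>

lemma lc_dualI:
  assumes lin: "Vector_Spaces.linear sc (*) \<psi>" and F: "finite F" "F \<subseteq> Ps" "C \<ge> 0"
    and bound: "\<And>x. norm (\<psi> x) \<le> C * (\<Sum>q\<in>F. q x)"
  shows "\<psi> \<in> lc_dual sc Ps"
proof -
  have "lc_continuous Ps \<psi>"
    unfolding lc_continuous_def
  proof (intro allI impI)
    fix x and \<epsilon> :: real assume \<epsilon>: "\<epsilon> > 0"
    \<comment> \<open>The summand 1 keeps \<open>c\<close> positive when \<open>F\<close> is empty
      or \<open>C = 0\<close>, and makes the final estimate strict.\<close>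
    define c where "c = C * card F + 1"
    define \<eta> where "\<eta> = \<epsilon> / c"
    have c: "c > 0" unfolding c_def using F by (simp add: add_nonneg_pos)
    then have \<eta>: "\<eta> > 0" unfolding \<eta>_def using \<epsilon> by simp
    have "dist (\<psi> (x + u)) (\<psi> x) < \<epsilon>" if u: "\<forall>q\<in>F. q u < \<eta>" for u
    proof -
      have "dist (\<psi> (x + u)) (\<psi> x) = norm (\<psi> u)"
        using lin unfolding linear_functional_iff by (simp add: dist_norm)
      also have "\<dots> \<le> C * (\<Sum>q\<in>F. q u)" by (rule bound)
      also have "\<dots> \<le> C * (card F * \<eta>)"
        using u F by (intro mult_left_mono sum_bounded_above) auto
      also have "\<dots> < c * \<eta>" unfolding c_def using \<eta> by (simp add: algebra_simps)
      also have "\<dots> = \<epsilon>" unfolding \<eta>_def using c by simp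
      finally show ?thesis .
    qed
    then show "\<exists>U. zero_nhd Ps U \<and> (\<forall>u\<in>U. dist (\<psi> (x + u)) (\<psi> x) < \<epsilon>)"
      using F \<eta> by (intro exI[of _ "{u. \<forall>q\<in>F. q u < \<eta>}"]) (auto simp: zero_nhd_def)
  qed
  with lin show ?thesis unfolding lc_dual_def by blast
qed

text \<open>Continuity at 0 with tolerance 1 gives a basic neighbourhood; any \<open>x\<close> is
  rescaled into it and homogeneity gives the bound.\<close>

lemma lc_dual_bound:
  assumes \<psi>: "\<psi> \<in> lc_dual sc Ps"
  obtains F C where "finite F" "F \<subseteq> Ps" "C \<ge> 0" "\<And>x. norm (\<psi> x) \<le> C * (\<Sum>q\<in>F. q x)"
proof -
  have "lc_continuous Ps \<psi>" using \<psi> unfolding lc_dual_def by blast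
  then obtain U where "zero_nhd Ps U" "\<forall>u\<in>U. dist (\<psi> (0 + u)) (\<psi> 0) < 1"
    unfolding lc_continuous_def using zero_less_one by blast
  then obtain F \<epsilon> where F: "finite F" "F \<subseteq> Ps" and \<epsilon>: "\<epsilon> > 0"
    and small: "\<And>u. \<forall>q\<in>F. q u < \<epsilon> \<Longrightarrow> norm (\<psi> u) < 1"
    unfolding zero_nhd_def using lc_dual_linearD(3)[OF \<psi>]
    by (auto simp: subset_iff)
  have "norm (\<psi> x) \<le> (1 / \<epsilon>) * (\<Sum>q\<in>F. q x)" for x
  proof (rule field_le_epsilon)
    fix e :: real assume e: "e > 0"
    \<comment> \<open>All seminorms in \<open>F\<close> may vanish at \<open>x\<close>, so the
      scaling factor gets the positive slack \<open>\<epsilon> * e\<close>, which costs exactly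
      \<open>e\<close> at the end.\<close>
    define t where "t = (\<Sum>q\<in>F. q x) + \<epsilon> * e"
    have nonneg: "0 \<le> (\<Sum>q\<in>F. q x)" using F lcs_nonneg by (intro sum_nonneg) auto
    have t: "t > 0" unfolding t_def using nonneg e \<epsilon> by (simp add: add_nonneg_pos)
    have "norm (\<psi> (sc (of_real (\<epsilon> / t)) x)) < 1"
    proof (rule small, rule ballI)
      fix q assume q: "q \<in> F"
      have "q x \<le> (\<Sum>q\<in>F. q x)"
        using F q lcs_nonneg by (intro member_le_sum) auto
      then have "q x < t" unfolding t_def using mult_pos_pos[OF \<epsilon> e] by linarith
      moreover have "q (sc (of_real (\<epsilon> / t)) x) = \<epsilon> / t * q x"
        using lcs_scale[of q "of_real (\<epsilon> / t)" x] q F \<epsilon> t unfolding norm_of_real by auto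
      moreover have "\<epsilon> / t * q x < \<epsilon> / t * t" using \<open>q x < t\<close> \<epsilon> t by (intro mult_strict_left_mono) auto
      ultimately show "q (sc (of_real (\<epsilon> / t)) x) < \<epsilon>" using t by simp
    qed
    then have "\<epsilon> / t * norm (\<psi> x) < 1"
      unfolding lc_dual_linearD(2)[OF \<psi>] norm_mult norm_of_real using t \<epsilon> by simp
    then have "norm (\<psi> x) < t / \<epsilon>" using t \<epsilon> by (simp add: field_simps)
    also have "\<dots> = (1 / \<epsilon>) * (\<Sum>q\<in>F. q x) + e"
      unfolding t_def using \<epsilon> by (simp add: field_simps)
    finally show "norm (\<psi> x) \<le> (1 / \<epsilon>) * (\<Sum>q\<in>F. q x) + e" by simp
  qed
  with F \<epsilon> show thesis by (intro that[of F "1 / \<epsilon>"]) auto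
qed

lemma lc_dual_bounded:
  assumes "\<psi> \<in> lc_dual sc Ps" "lc_bounded Ps B"
  shows "\<exists>M. \<forall>x\<in>B. norm (\<psi> x) \<le> M"
proof -
  obtain F C where F: "finite F" "F \<subseteq> Ps" "C \<ge> 0" and b: "\<And>x. norm (\<psi> x) \<le> C * (\<Sum>q\<in>F. q x)"
    using lc_dual_bound[OF assms(1)] by metis
  have "norm (\<psi> x) \<le> C * (\<Sum>q\<in>F. Sup (q ` B))" if "x \<in> B" for x
  proof -
    have "q x \<le> Sup (q ` B)" if "q \<in> F" for q
      using \<open>x \<in> B\<close> that F assms(2) unfolding lc_bounded_def by (intro cSUP_upper) auto
    then have "C * (\<Sum>q\<in>F. q x) \<le> C * (\<Sum>q\<in>F. Sup (q ` B))"
      using F by (intro mult_left_mono sum_mono) auto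
    with b[of x] show ?thesis by linarith
  qed
  then show ?thesis by blast
qed

text \<open>The finitely many dominating families are merged into their union \<open>G\<close>;
  nonnegativity of seminorms lets each bound be enlarged to \<open>G\<close>.\<close>

lemma lc_dual_scaled_sum:
  assumes I: "finite I" and \<psi>: "\<And>i. i \<in> I \<Longrightarrow> \<psi> i \<in> lc_dual sc Ps"
  shows "(\<lambda>x. \<Sum>i\<in>I. c i * \<psi> i x) \<in> lc_dual sc Ps"
proof -
  have "\<forall>i\<in>I. \<exists>F C. finite F \<and> F \<subseteq> Ps \<and> C \<ge> 0 \<and> (\<forall>x. norm (\<psi> i x) \<le> C * (\<Sum>q\<in>F. q x))"
    using lc_dual_bound[OF \<psi>] by metis
  then obtain F C where F: "\<And>i. i \<in> I \<Longrightarrow> finite (F i)" "\<And>i. i \<in> I \<Longrightarrow> F i \<subseteq> Ps"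
    "\<And>i. i \<in> I \<Longrightarrow> C i \<ge> 0" and b: "\<And>i x. i \<in> I \<Longrightarrow> norm (\<psi> i x) \<le> C i * (\<Sum>q\<in>F i. q x)"
    by metis
  define G where "G = (\<Union>i\<in>I. F i)"
  show ?thesis
  proof (rule lc_dualI)
    show "Vector_Spaces.linear sc (*) (\<lambda>x. \<Sum>i\<in>I. c i * \<psi> i x)"
      unfolding linear_functional_iff using lc_dual_linearD[OF \<psi>]
      by (auto simp: distrib_left sum.distrib sum_distrib_left mult_ac intro!: sum.cong)
    show G: "finite G" "G \<subseteq> Ps" "0 \<le> (\<Sum>i\<in>I. norm (c i) * C i)"
      unfolding G_def using I F by (auto intro!: sum_nonneg)
    fix x
    have "norm (\<Sum>i\<in>I. c i * \<psi> i x) \<le> (\<Sum>i\<in>I. norm (c i) * norm (\<psi> i x))"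
      by (rule sum_norm_le) (simp add: norm_mult)
    also have "\<dots> \<le> (\<Sum>i\<in>I. norm (c i) * C i * (\<Sum>q\<in>G. q x))"
    proof (rule sum_mono)
      fix i assume i: "i \<in> I"
      have "(\<Sum>q\<in>F i. q x) \<le> (\<Sum>q\<in>G. q x)"
        using i G lcs_nonneg by (intro sum_mono2) (auto simp: G_def)
      then have "C i * (\<Sum>q\<in>F i. q x) \<le> C i * (\<Sum>q\<in>G. q x)"
        using F(3)[OF i] by (intro mult_left_mono)
      with b[OF i, of x] have "norm (\<psi> i x) \<le> C i * (\<Sum>q\<in>G. q x)" by linarith
      then show "norm (c i) * norm (\<psi> i x) \<le> norm (c i) * C i * (\<Sum>q\<in>G. q x)"
        by (simp add: mult.assoc mult_left_mono)
    qed
    finally show "norm (\<Sum>i\<in>I. c i * \<psi> i x) \<le> (\<Sum>i\<in>I. norm (c i) * C i) * (\<Sum>q\<in>G. q x)"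
      by (simp add: sum_distrib_right)
  qed
qed

lemma lc_dual_scaled:
  assumes "\<psi> \<in> lc_dual sc Ps" shows "(\<lambda>x. c * \<psi> x) \<in> lc_dual sc Ps"
  using lc_dual_scaled_sum[of "{()}" "\<lambda>_. \<psi>" "\<lambda>_. c"] assms by simp

section \<open>Weak* summable sequences and boundedness of limited sets\<close>

lemma weak_star_summable_dual: "weak_star_summable sc Ps p \<psi> \<Longrightarrow> \<psi> n \<in> lc_dual sc Ps"
  unfolding weak_star_summable_def by blast

lemma weak_star_summable_tendsto_zero:
  assumes "weak_star_summable sc Ps p \<psi>" shows "(\<lambda>n. \<psi> n x) \<longlonglongrightarrow> 0"
  using assms unfolding weak_star_summable_def
  by (metis summable_LIMSEQ_zero tendsto_norm_zero_cancel)

text \<open>Absolute summability implies convergence to 0, so one criterion serves every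
  \<open>p\<close>.\<close>

lemma weak_star_summableI:
  assumes "\<And>n. \<psi> n \<in> lc_dual sc Ps" "\<And>x. summable (\<lambda>n. norm (\<psi> n x))"
  shows "weak_star_summable sc Ps p \<psi>"
  using assms unfolding weak_star_summable_def
  by (auto intro: tendsto_norm_zero_cancel summable_LIMSEQ_zero)

lemma weak_star_summable_scaled:
  assumes "weak_star_summable sc Ps p \<psi>"
  shows "weak_star_summable sc Ps p (\<lambda>n x. c * \<psi> n x)"
  using assms lc_dual_scaled unfolding weak_star_summable_def
  by (auto simp: norm_mult intro: tendsto_mult_right_zero summable_mult)

lemma weak_star_summable_subsequence:
  assumes "weak_star_summable sc Ps p \<psi>" "strict_mono r"
  shows "weak_star_summable sc Ps p (\<lambda>n. \<psi> (r n))"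
proof -
  have "summable (\<lambda>n. norm (\<psi> (r n) x))" if "summable (\<lambda>n. norm (\<psi> n x))" for x
    using summable_block_sums[OF that, of "\<lambda>n. {r n}"] assms(2)
    by (auto simp: disjoint_family_on_def strict_mono_eq)
  moreover have "(\<lambda>n. \<psi> (r n) x) \<longlonglongrightarrow> 0" if "(\<lambda>n. \<psi> n x) \<longlonglongrightarrow> 0" for x
    using LIMSEQ_subseq_LIMSEQ[OF that assms(2)] by (simp add: comp_def)
  ultimately show ?thesis using assms(1) unfolding weak_star_summable_def by auto
qed

lemma weak_star_sup_on_tendsto_zero_iff:
  assumes "weak_star_summable sc Ps p \<psi>"
  shows "(\<lambda>n. sup_on (\<psi> n) A) \<longlonglongrightarrow> 0 \<longleftrightarrow> (\<forall>\<epsilon>>0. \<forall>\<^sub>F n in sequentially. \<forall>x\<in>A. norm (\<psi> n x) < \<epsilon>)"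
  using sup_on_tendsto_zero_iff lc_dual_linearD(3) weak_star_summable_dual[OF assms] by blast

lemma p_infty_limitedD:
  assumes "p_infty_limited sc Ps p A" "weak_star_summable sc Ps p \<psi>" "\<epsilon> > 0"
  shows "\<forall>\<^sub>F n in sequentially. \<forall>x\<in>A. norm (\<psi> n x) < \<epsilon>"
  using assms weak_star_sup_on_tendsto_zero_iff unfolding p_infty_limited_def by blast

lemma p_infty_limited_imp_bounded:
  assumes K: "real_or_complex TYPE('k)" and A: "p_infty_limited sc Ps p A"
  shows "lc_bounded Ps A"
proof (rule ccontr)
  assume "\<not> lc_bounded Ps A"
  then obtain q where q: "q \<in> Ps" "\<not> bdd_above (q ` A)" unfolding lc_bounded_def by auto
  have "\<exists>x\<in>A. 2 ^ n < q x" for n :: nat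
    using q(2) unfolding bdd_above_def by (metis imageE linorder_not_less)
  then obtain x where x: "\<And>n. x n \<in> A" "\<And>n. 2 ^ n < q (x n)" by metis
  have "\<exists>f. Vector_Spaces.linear sc (*) f \<and> (\<forall>y. norm (f y) \<le> q y) \<and> norm (f (x n)) = q (x n)" for n
    using hahn_banach_seminorm[OF K lcs_vector_space lcs_seminorm[OF q(1)]] by metis
  then obtain f where f: "\<And>n. Vector_Spaces.linear sc (*) (f n)" "\<And>n y. norm (f n y) \<le> q y"
    "\<And>n. norm (f n (x n)) = q (x n)" by metis
  have dual: "f n \<in> lc_dual sc Ps" for n
    using f q by (intro lc_dualI[of _ "{q}" 1]) auto
  define \<psi> where "\<psi> n y = (1 / 2) ^ n * f n y" for n y
  have norm_\<psi>: "norm (\<psi> n y) = (1 / 2) ^ n * norm (f n y)" for n y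
    unfolding \<psi>_def by (simp add: norm_mult norm_power norm_divide)
  have "weak_star_summable sc Ps p \<psi>"
  proof (rule weak_star_summableI)
    show "\<psi> n \<in> lc_dual sc Ps" for n unfolding \<psi>_def by (rule lc_dual_scaled[OF dual])
    fix y
    have "summable (\<lambda>n. (1 / 2) ^ n * q y)" by (intro summable_mult2 summable_geometric) auto
    then show "summable (\<lambda>n. norm (\<psi> n y))"
      by (rule summable_comparison_test'[of _ 0]) (simp add: norm_\<psi> f mult_left_mono)
  qed
  then have "\<forall>\<^sub>F n in sequentially. \<forall>x\<in>A. norm (\<psi> n x) < 1"
    using p_infty_limitedD[OF A] by simp
  then obtain n where "norm (\<psi> n (x n)) < 1"
    using x(1) by (auto simp: eventually_sequentially)
  then have "q (x n) < 2 ^ n" unfolding norm_\<psi> f(3) by (simp add: field_simps power_divide)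
  with x(2)[of n] show False by simp
qed

section \<open>Separated sets and precompactness\<close>

text \<open>Finitely many translates of \<open>U\<close> never cover \<open>A\<close>, so points can
  be chosen successively outside the translates at the earlier ones.\<close>

lemma not_precompact_imp_separated_subset:
  assumes "\<not> lc_precompact Ps A"
  obtains D where "D \<subseteq> A" "infinite D" "separated Ps D"
proof -
  obtain U where U: "zero_nhd Ps U" and cover: "\<And>K. finite K \<Longrightarrow> \<not> A \<subseteq> (\<Union>k\<in>K. (\<lambda>u. k + u) ` U)"
    using assms unfolding lc_precompact_def by blast
  obtain F \<epsilon> where F: "finite F" "F \<subseteq> Ps" "\<epsilon> > 0" and FU: "{x. \<forall>q\<in>F. q x < \<epsilon>} \<subseteq> U"
    using U unfolding zero_nhd_def by blast
  \<comment> \<open>The construction controls only differences of a later and an earlier point. The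
    basic neighbourhood \<open>V\<close> is symmetric, unlike \<open>U\<close>, and so settles both
    orders.\<close>
  define V where "V = {x. \<forall>q\<in>F. q x < \<epsilon>}"
  have "\<exists>x. x \<in> A \<and> (\<forall>k\<in>K. x - k \<notin> V)" if K: "finite K" for K
  proof -
    obtain x where x: "x \<in> A" "x \<notin> (\<Union>k\<in>K. (\<lambda>u. k + u) ` U)" using cover[OF K] by blast
    have "x - k \<notin> V" if "k \<in> K" for k
    proof
      assume "x - k \<in> V"
      then have "k + (x - k) \<in> (\<Union>k\<in>K. (\<lambda>u. k + u) ` U)" using that FU unfolding V_def by blast
      with x(2) show False by simp
    qed
    with x(1) show ?thesis by blast
  qed
  then obtain x :: "nat \<Rightarrow> 'a" where x: "\<And>n. x n \<in> A" "\<And>k n. k < n \<Longrightarrow> x n - x k \<notin> V"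
    by (rule exists_sequence_avoiding_history[where R = "\<lambda>k x. x - k \<notin> V"]) blast+
  have sep: "x n - x k \<notin> V" if "k \<noteq> n" for k n
  proof (cases "k < n")
    case False
    then have "x k - x n \<notin> V" using x(2) that by simp
    then obtain q where q: "q \<in> F" "\<not> q (x k - x n) < \<epsilon>" unfolding V_def by blast
    then have "q (x k - x n) = q (x n - x k)" using lcs_minus[of q "x n - x k"] F by auto
    with q show ?thesis unfolding V_def by auto
  qed (use x in simp)
  have "q 0 < \<epsilon>" if "q \<in> F" for q using that F lcs_zero[of q] by auto
  then have "0 \<in> V" unfolding V_def by blast
  then have "inj x" using sep by (metis diff_self injI)
  then have "infinite (range x)" by (rule range_inj_infinite)
  moreover have "separated Ps (range x)"
    unfolding separated_def
  proof (intro exI conjI)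
    show "zero_nhd Ps V" unfolding zero_nhd_def V_def using F by blast
    show "\<forall>a\<in>range x. \<forall>a'\<in>range x. a \<noteq> a' \<longrightarrow> a - a' \<notin> V" using sep by (metis rangeE)
  qed
  ultimately show thesis using that x(1) by blast
qed

lemma infinite_separated_imp_not_precompact:
  assumes "infinite D" "separated Ps D"
  shows "\<not> lc_precompact Ps D"
proof
  assume pre: "lc_precompact Ps D"
  obtain U where U: "zero_nhd Ps U" "\<And>a a'. a \<in> D \<Longrightarrow> a' \<in> D \<Longrightarrow> a \<noteq> a' \<Longrightarrow> a - a' \<notin> U"
    using assms(2) unfolding separated_def by blast
  obtain F \<epsilon> where F: "finite F" "F \<subseteq> Ps" "\<epsilon> > 0" and FU: "{x. \<forall>q\<in>F. q x < \<epsilon>} \<subseteq> U"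
    using U unfolding zero_nhd_def by blast
  \<comment> \<open>Half the radius: two points in one translate of \<open>V\<close> differ by an
    element of \<open>U\<close>, so each centre serves at most one point of
    \<open>D\<close>.\<close>
  define V where "V = {x. \<forall>q\<in>F. q x < \<epsilon> / 2}"
  have "zero_nhd Ps V" unfolding zero_nhd_def V_def using F by (meson half_gt_zero order_refl)
  then obtain K where K: "finite K" "D \<subseteq> (\<Union>k\<in>K. (\<lambda>u. k + u) ` V)"
    using pre unfolding lc_precompact_def by blast
  then have "\<forall>d\<in>D. \<exists>k. k \<in> K \<and> d - k \<in> V" by fastforce
  then obtain c where c: "\<And>d. d \<in> D \<Longrightarrow> c d \<in> K" "\<And>d. d \<in> D \<Longrightarrow> d - c d \<in> V" by metis
  have "inj_on c D"
  proof (rule inj_onI, rule ccontr)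
    fix a b assume ab: "a \<in> D" "b \<in> D" "c a = c b" "a \<noteq> b"
    have "q (a - b) < \<epsilon>" if q: "q \<in> F" for q
    proof -
      have "q ((a - c a) - (b - c b)) \<le> q (a - c a) + q (b - c b)"
        using q F by (intro lcs_diff) auto
      also have "\<dots> < \<epsilon>" using c(2)[OF ab(1)] c(2)[OF ab(2)] q unfolding V_def by fastforce
      finally show ?thesis using ab(3) by simp
    qed
    then have "a - b \<in> U" using FU by blast
    with U(2) ab show False by blast
  qed
  then have "finite D" using K(1) c(1) by (meson finite_imageD finite_subset image_subsetI)
  with assms(1) show False by simp
qed

text \<open>The witness is rescaled, then thinned out greedily: pointwise convergence to 0 makes
  late functionals small at the finitely many points already chosen.\<close>

lemma summable_witness_imp_hump_sequence:
  assumes \<psi>: "weak_star_summable sc Ps p \<psi>" and nlim: "\<not> (\<lambda>n. sup_on (\<psi> n) D) \<longlonglongrightarrow> 0"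
    and \<delta>: "\<delta> > 0"
  obtains x f where "\<And>n. x n \<in> D" "weak_star_summable sc Ps p f"
    "\<And>n k. k < n \<Longrightarrow> norm (f n (x k)) < \<delta>" "\<And>n. norm (f n (x n)) > 1 + \<delta>"
proof -
  obtain \<epsilon> where \<epsilon>: "\<epsilon> > 0" and "\<not> (\<forall>\<^sub>F n in sequentially. \<forall>x\<in>D. norm (\<psi> n x) < \<epsilon>)"
    using nlim weak_star_sup_on_tendsto_zero_iff[OF \<psi>] by blast
  then have large: "\<exists>n>m. \<exists>x\<in>D. norm (\<psi> n x) \<ge> \<epsilon>" for m
    unfolding eventually_sequentially by (metis le_eq_less_or_eq lessI linorder_not_less order_less_le_trans)
  \<comment> \<open>The factor lifts values of size at least \<open>\<epsilon>\<close> to at least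
    \<open>2 + \<delta>\<close>, strictly above the required \<open>1 + \<delta>\<close>.\<close>
  define c :: 'k where "c = of_real ((2 + \<delta>) / \<epsilon>)"
  define \<phi> where "\<phi> n x = c * \<psi> n x" for n x
  have \<phi>: "weak_star_summable sc Ps p \<phi>"
    unfolding \<phi>_def by (rule weak_star_summable_scaled[OF \<psi>])
  have norm_\<phi>: "norm (\<phi> n x) > 1 + \<delta>" if "norm (\<psi> n x) \<ge> \<epsilon>" for n x
  proof -
    have "1 + \<delta> < (2 + \<delta>) / \<epsilon> * \<epsilon>" using \<epsilon> by simp
    also have "\<dots> \<le> (2 + \<delta>) / \<epsilon> * norm (\<psi> n x)"
      using that \<epsilon> \<delta> by (intro mult_left_mono) auto
    also have "\<dots> = norm (\<phi> n x)" unfolding \<phi>_def c_def norm_mult norm_of_real using \<epsilon> \<delta> by simp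
    finally show ?thesis .
  qed
  \<comment> \<open>An index and a point are chosen together; \<open>R\<close> also makes the
    indices increase, so that the functionals form a subsequence.\<close>
  define P where "P = (\<lambda>(n, x). x \<in> D \<and> norm (\<phi> n x) > 1 + \<delta>)"
  define R where "R = (\<lambda>(m, y) (n, x::'a). (m::nat) < n \<and> norm (\<phi> n y) < \<delta>)"
  have "\<exists>z. P z \<and> (\<forall>k\<in>K. R k z)" if K: "finite K" for K
  proof -
    have "\<forall>\<^sub>F n in sequentially. fst k < n \<and> norm (\<phi> n (snd k)) < \<delta>" for k
    proof (intro eventually_conj eventually_gt_at_top)
      have "(\<lambda>n. norm (\<phi> n (snd k))) \<longlonglongrightarrow> 0"
        using weak_star_summable_tendsto_zero[OF \<phi>] by (rule tendsto_norm_zero)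
      then show "\<forall>\<^sub>F n in sequentially. norm (\<phi> n (snd k)) < \<delta>"
        using \<delta> by (intro order_tendstoD) auto
    qed
    then have "\<forall>\<^sub>F n in sequentially. \<forall>k\<in>K. fst k < n \<and> norm (\<phi> n (snd k)) < \<delta>"
      using K by (intro eventually_ball_finite) auto
    then obtain m where m: "\<And>n. n \<ge> m \<Longrightarrow> \<forall>k\<in>K. fst k < n \<and> norm (\<phi> n (snd k)) < \<delta>"
      unfolding eventually_sequentially by blast
    obtain n x where n: "n > m" "x \<in> D" "norm (\<psi> n x) \<ge> \<epsilon>" using large by blast
    then have "P (n, x)" unfolding P_def using norm_\<phi> by simp
    moreover have "\<forall>k\<in>K. R k (n, x)" unfolding R_def using m[of n] n(1) by auto
    ultimately show ?thesis by blast
  qed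
  then obtain z where z: "\<And>n::nat. P (z n)" "\<And>k n. k < n \<Longrightarrow> R (z k) (z n)"
    by (rule exists_sequence_avoiding_history[where P = P and R = R]) blast+
  have "strict_mono (\<lambda>n. fst (z n))"
    using z(2) unfolding R_def by (auto intro!: strict_monoI simp: case_prod_unfold)
  then have "weak_star_summable sc Ps p (\<lambda>n. \<phi> (fst (z n)))"
    by (rule weak_star_summable_subsequence[OF \<phi>])
  with z show thesis
    by (intro that[of "\<lambda>n. snd (z n)" "\<lambda>n. \<phi> (fst (z n))"]) (auto simp: P_def R_def case_prod_unfold)
qed

section \<open>Coordinate operators and their images\<close>

text \<open>Together with \<open>coord_operatorD\<close>: by swapping arguments, these operators are
  the same objects as weak* summable sequences.\<close>

lemma coord_operatorI:
  assumes "weak_star_summable sc Ps p f"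
  shows "coord_operator sc Ps p (\<lambda>x n. f n x)"
proof -
  have "vector_space (\<lambda>(c::'k) y (i::nat). c * y i)"
    by unfold_locales (auto simp: algebra_simps)
  then have "Vector_Spaces.linear sc (\<lambda>c y i. c * y i) (\<lambda>x n. f n x)"
    using lcs_vector_space lc_dual_linearD[OF weak_star_summable_dual[OF assms]]
    unfolding Vector_Spaces.linear_iff by (auto simp: fun_eq_iff)
  then show ?thesis
    using assms unfolding coord_operator_def weak_star_summable_def lc_dual_def in_c0_def in_l1_def
    by auto
qed

lemma coord_operatorD:
  assumes "coord_operator sc Ps p T"
  shows "weak_star_summable sc Ps p (\<lambda>n x. T x n)"
proof -
  have "Vector_Spaces.linear sc (*) (\<lambda>x. T x n)" for n
    unfolding linear_functional_iff
    using assms unfolding coord_operator_def Vector_Spaces.linear_iff by auto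
  then show ?thesis
    using assms unfolding coord_operator_def weak_star_summable_def lc_dual_def in_c0_def in_l1_def
    by auto
qed

lemma coord_operator_coordinate_le:
  assumes "coord_operator sc Ps p T"
  shows "norm (T x i - T y i) \<le> (if p = \<infinity> then sup_norm else l1_norm) (T x - T y)"
proof -
  have eq: "T x - T y = T (x - y)"
    using lc_dual_linearD(4)[OF weak_star_summable_dual[OF coord_operatorD[OF assms]]]
    by (simp add: fun_eq_iff)
  then have "norm (T x i - T y i) = norm (T (x - y) i)" by (metis minus_apply)
  then show ?thesis
    using assms eq norm_coordinate_le_sup_norm[of "T (x - y)"] norm_coordinate_le_l1_norm[of "T (x - y)"]
    unfolding coord_operator_def by (auto split: if_splits)
qed

text \<open>By pigeonhole two points \<open>x m\<close>, \<open>x n\<close> with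
  \<open>m < n\<close> share a centre, so their images differ by less than 1 in coordinate
  \<open>n\<close>, whereas the humps force more than 1.\<close>

lemma hump_sequence_imp_not_norm_precompact:
  assumes T: "coord_operator sc Ps p T" and x: "\<And>n. x n \<in> D"
    and small: "\<And>n k. k < n \<Longrightarrow> norm (T (x k) n) < \<delta>" and big: "\<And>n. norm (T (x n) n) > 1 + \<delta>"
  shows "\<not> norm_precompact (if p = \<infinity> then sup_norm else l1_norm) (T ` D)" (is "\<not> norm_precompact ?N _")
proof
  assume "norm_precompact ?N (T ` D)"
  then obtain K where K: "finite K" "K \<subseteq> T ` D" "T ` D \<subseteq> (\<Union>k\<in>K. {y. ?N (y - k) < 1 / 2})"
    unfolding norm_precompact_def by (meson half_gt_zero zero_less_one)
  have "\<exists>k\<in>K. ?N (T (x n) - k) < 1 / 2" for n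
    using K(3) x[of n] by blast
  then obtain k where k: "\<And>n. k n \<in> K" "\<And>n. ?N (T (x n) - k n) < 1 / 2" by metis
  have "\<not> inj k" using k(1) K(1) by (metis finite_subset image_subsetI range_inj_infinite)
  then obtain m n where mn: "m < n" "k m = k n" by (metis injI linorder_neqE_nat)
  obtain d where d: "k n = T d" using k(1) K(2) by blast
  have near: "norm (T (x l) n - T d n) < 1 / 2" if "k l = T d" for l
    using coord_operator_coordinate_le[OF T, of "x l" n d] k(2)[of l] that by (simp split: if_splits)
  have "norm (T (x n) n) \<le> norm (T (x n) n - T d n) + norm (T (x m) n - T d n) + norm (T (x m) n)"
    using norm_triangle_ineq4[of "T (x n) n - T d n" "T (x m) n - T d n"]
      norm_triangle_sub[of "T (x n) n" "T (x m) n"] by simp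
  also have "\<dots> < 1 / 2 + 1 / 2 + \<delta>"
    using near[of n] near[of m] d mn small[of m n] by (intro add_strict_mono) auto
  finally show False using big[of n] by simp
qed

text \<open>Gliding hump: if the tails were not uniformly small, unimodular combinations of the
  coordinates over consecutive blocks would be a weak* 1-summable sequence that is not uniformly
  null on \<open>A\<close>.\<close>
lemma limited_imp_uniform_l1_tails:
  assumes A: "p_infty_limited sc Ps p A" and \<psi>: "\<And>n. \<psi> n \<in> lc_dual sc Ps"
    and sum: "\<And>x. summable (\<lambda>n. norm (\<psi> n x))" and \<epsilon>: "\<epsilon> > 0"
  shows "\<exists>m. \<forall>d\<in>A. (\<Sum>i. norm (\<psi> (i + m) d)) \<le> \<epsilon>"
proof (rule ccontr)
  assume "\<not> ?thesis"
  then have tail: "\<exists>d\<in>A. (\<Sum>i. norm (\<psi> (i + m) d)) > \<epsilon>" for m by (meson linorder_not_less)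
  have block: "\<exists>b d. d \<in> A \<and> (\<Sum>i\<in>{a..<b}. norm (\<psi> i d)) > \<epsilon>" for a
  proof -
    obtain d where d: "d \<in> A" "(\<Sum>i. norm (\<psi> (i + a) d)) > \<epsilon>" using tail by blast
    \<comment> \<open>A tail exceeding \<open>\<epsilon>\<close> strictly has a finite partial sum
      that already does.\<close>
    have "(\<lambda>m. \<Sum>i<m. norm (\<psi> (i + a) d)) \<longlonglongrightarrow> (\<Sum>i. norm (\<psi> (i + a) d))"
      using sum[of d] by (intro summable_LIMSEQ summable_ignore_initial_segment)
    then have "\<forall>\<^sub>F m in sequentially. (\<Sum>i<m. norm (\<psi> (i + a) d)) > \<epsilon>"
      using d(2) by (rule order_tendstoD)
    then obtain m where "(\<Sum>i<m. norm (\<psi> (i + a) d)) > \<epsilon>"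
      by (auto simp: eventually_sequentially)
    also have "(\<Sum>i<m. norm (\<psi> (i + a) d)) = (\<Sum>i\<in>{a..<m + a}. norm (\<psi> i d))"
      using sum.shift_bounds_nat_ivl[of "\<lambda>i. norm (\<psi> i d)" 0 a m] by (simp add: lessThan_atLeast0)
    finally show ?thesis using d(1) by blast
  qed
  \<comment> \<open>A triple holds the two ends of a block and the point at which the block is
    heavy.\<close>
  define P where "P = (\<lambda>(a, b, d). d \<in> A \<and> (\<Sum>i\<in>{a..<b}. norm (\<psi> i d)) > \<epsilon>)"
  define R where "R = (\<lambda>(a::nat, b, d::'a) (a', b'::nat, d'::'a). (b::nat) \<le> a')"
  have "\<exists>z. P z \<and> (\<forall>k\<in>K. R k z)" if K: "finite K" for K
  proof -
    \<comment> \<open>The new block starts where all the earlier ones have ended; the inserted 0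
      covers the empty history.\<close>
    define a where "a = Max (insert 0 ((\<lambda>k. fst (snd k)) ` K))"
    obtain b d where "P (a, b, d)" unfolding P_def using block[of a] by auto
    moreover have "\<forall>k\<in>K. R k (a, b, d)"
      unfolding R_def a_def using K by (auto simp: case_prod_unfold intro!: Max_ge)
    ultimately show ?thesis by blast
  qed
  then obtain z where z: "\<And>n::nat. P (z n)" "\<And>k n. k < n \<Longrightarrow> R (z k) (z n)"
    by (rule exists_sequence_avoiding_history[where P = P and R = R]) blast+
  define I where "I n = {fst (z n)..<fst (snd (z n))}" for n
  define d where "d n = snd (snd (z n))" for n
  have d: "d n \<in> A" "(\<Sum>i\<in>I n. norm (\<psi> i (d n))) > \<epsilon>" for n
    using z(1)[of n] unfolding P_def I_def d_def by (auto simp: case_prod_unfold)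
  have "I k \<inter> I n = {}" if "k < n" for k n
    using z(2)[OF that] unfolding R_def I_def by (auto simp: case_prod_unfold)
  then have disj: "disjoint_family I"
    unfolding disjoint_family_on_def by (metis Int_commute linorder_neqE_nat)
  \<comment> \<open>These phases rule out cancellation at \<open>d n\<close>. Where
    \<open>\<psi> i (d n) = 0\<close>, division by zero gives 0 and both properties persist.\<close>
  define u where "u n i = of_real (norm (\<psi> i (d n))) / \<psi> i (d n)" for n i
  have u: "norm (u n i) \<le> 1" "u n i * \<psi> i (d n) = of_real (norm (\<psi> i (d n)))" for n i
    unfolding u_def by (auto simp: norm_divide)
  define g where "g n x = (\<Sum>i\<in>I n. u n i * \<psi> i x)" for n x
  have g_le: "norm (g n x) \<le> (\<Sum>i\<in>I n. norm (\<psi> i x))" for n x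
    unfolding g_def by (rule sum_norm_le) (simp add: norm_mult u mult_left_le_one_le)
  have "weak_star_summable sc Ps p g"
  proof (rule weak_star_summableI)
    show "g n \<in> lc_dual sc Ps" for n
      unfolding g_def using \<psi> by (intro lc_dual_scaled_sum) (auto simp: I_def)
    fix x
    have "summable (\<lambda>n. \<Sum>i\<in>I n. norm (\<psi> i x))"
      using sum by (intro summable_block_sums disj) (auto simp: I_def)
    then show "summable (\<lambda>n. norm (g n x))"
      by (rule summable_comparison_test'[of _ 0]) (simp add: g_le)
  qed
  then have "\<forall>\<^sub>F n in sequentially. \<forall>x\<in>A. norm (g n x) < \<epsilon>"
    using p_infty_limitedD[OF A] \<epsilon> by blast
  then obtain n where "norm (g n (d n)) < \<epsilon>" using d(1) by (auto simp: eventually_sequentially)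
  moreover have "g n (d n) = of_real (\<Sum>i\<in>I n. norm (\<psi> i (d n)))"
    unfolding g_def by (simp add: u)
  then have "norm (g n (d n)) = \<bar>\<Sum>i\<in>I n. norm (\<psi> i (d n))\<bar>" by (metis norm_of_real)
  ultimately show False using d(2)[of n] by linarith
qed

text \<open>Smallness of late coordinates, uniform on \<open>A\<close>, restricts to the subset
  \<open>D\<close>; in the final contradiction \<open>D\<close> is a separated subset of
  \<open>A\<close>.\<close>

lemma limited_imp_operator_image_precompact:
  assumes K: "real_or_complex TYPE('k)" and A: "p_infty_limited sc Ps p A" and D: "D \<subseteq> A"
    and T: "coord_operator sc Ps p T"
  shows "norm_precompact (if p = \<infinity> then sup_norm else l1_norm) (T ` D)"
proof (rule norm_precompactI[OF K])
  have ws: "weak_star_summable sc Ps p (\<lambda>n x. T x n)" by (rule coord_operatorD[OF T])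
  show "\<exists>M. \<forall>y\<in>T ` D. norm (y i) \<le> M" for i
    using lc_dual_bounded[OF weak_star_summable_dual[OF ws, of i] p_infty_limited_imp_bounded[OF K A]] D
    by blast
  fix \<epsilon> :: real assume \<epsilon>: "\<epsilon> > 0"
  show "\<exists>m \<eta>. \<eta> > 0 \<and> (\<forall>y\<in>T ` D. \<forall>z\<in>T ` D. (\<forall>i<m. norm (y i - z i) < \<eta>) \<longrightarrow>
      (if p = \<infinity> then sup_norm else l1_norm) (y - z) < \<epsilon>)"
  proof (cases "p = \<infinity>")
    case True
    have "\<forall>\<^sub>F n in sequentially. \<forall>x\<in>A. norm (T x n) < \<epsilon> / 4"
      using p_infty_limitedD[OF A ws, of "\<epsilon> / 4"] \<epsilon> by simp
    then obtain m where m: "\<And>n x. n \<ge> m \<Longrightarrow> x \<in> D \<Longrightarrow> norm (T x n) < \<epsilon> / 4"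
      unfolding eventually_sequentially using D by blast
    \<comment> \<open>Late coordinates differ by at most twice \<open>\<epsilon> / 4\<close>. The
      bound \<open>\<epsilon> / 2\<close> leaves room because the supremum loses strictness.\<close>
    have "sup_norm (T a - T b) < \<epsilon>"
      if ab: "a \<in> D" "b \<in> D" "\<forall>i<m. norm (T a i - T b i) < \<epsilon> / 2" for a b
    proof -
      have "norm (T a i - T b i) \<le> \<epsilon> / 2" for i
      proof (cases "i < m")
        case False
        then show ?thesis
          using m[of i a] m[of i b] ab norm_triangle_ineq4[of "T a i" "T b i"] by simp
      qed (use ab in \<open>simp add: less_imp_le\<close>)
      then have "sup_norm (T a - T b) \<le> \<epsilon> / 2" by (intro sup_norm_le) simp
      with \<epsilon> show ?thesis by simp
    qed
    with True \<epsilon> show ?thesis by (intro exI[of _ m] exI[of _ "\<epsilon> / 2"]) auto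
  next
    case False
    then have l1: "in_l1 (T x)" for x using T unfolding coord_operator_def by simp
    have "\<exists>m. \<forall>d\<in>A. (\<Sum>i. norm (T d (i + m))) \<le> \<epsilon> / 4"
      using l1 \<epsilon> unfolding in_l1_def
      by (intro limited_imp_uniform_l1_tails[OF A, of "\<lambda>n x. T x n"] weak_star_summable_dual[OF ws]) auto
    then obtain m where m: "\<And>d. d \<in> D \<Longrightarrow> (\<Sum>i. norm (T d (i + m))) \<le> \<epsilon> / 4" using D by blast
    \<comment> \<open>The first \<open>m\<close> coordinates contribute at most
      \<open>\<epsilon> / 4\<close>, as does each of the two tails; the added 1 covers
      \<open>m = 0\<close>.\<close>
    define \<eta> where "\<eta> = \<epsilon> / (4 * (real m + 1))"
    have \<eta>: "\<eta> > 0" unfolding \<eta>_def using \<epsilon> by simp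
    have "l1_norm (T a - T b) < \<epsilon>"
      if ab: "a \<in> D" "b \<in> D" "\<forall>i<m. norm (T a i - T b i) < \<eta>" for a b
    proof -
      have "(\<Sum>i<m. norm (T a i - T b i)) \<le> real m * \<eta>"
        using ab(3) sum_bounded_above[of "{..<m}" "\<lambda>i. norm (T a i - T b i)" \<eta>]
        by (simp add: less_imp_le)
      also have "\<dots> \<le> (real m + 1) * \<eta>" using \<eta> by simp
      also have "\<dots> = \<epsilon> / 4" unfolding \<eta>_def by (simp add: field_simps)
      finally show ?thesis
        using l1_norm_diff_le[OF l1[of a] l1[of b], of m] m[OF ab(1)] m[OF ab(2)] \<epsilon> by linarith
    qed
    with False \<eta> show ?thesis by (intro exI[of _ m] exI[of _ \<eta>]) auto
  qed
qed

end

section \<open>The cycle of implications between the four conditions\<close>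

theorem theoremt:
  fixes sc :: "'k::real_normed_field \<Rightarrow> 'a::ab_group_add \<Rightarrow> 'a"
    and Ps :: "('a \<Rightarrow> real) set" and p :: ereal
  assumes "real_or_complex TYPE('k)"
    and "lcs sc Ps"
    and "p \<in> {1, \<infinity>}"
  shows
   "((\<forall>A. p_infty_limited sc Ps p A \<longrightarrow> lc_precompact Ps A)
     \<longleftrightarrow> (\<forall>B. lc_bounded Ps B \<and> \<not> lc_precompact Ps B \<longrightarrow>
            (\<exists>\<psi>. weak_star_summable sc Ps p \<psi> \<and> \<not> ((\<lambda>n. sup_on (\<psi> n) B) \<longlonglongrightarrow> 0))))
  \<and> ((\<forall>A. p_infty_limited sc Ps p A \<longrightarrow> lc_precompact Ps A)
     \<longleftrightarrow> (\<forall>D (\<delta>::real). infinite D \<and> lc_bounded Ps D \<and> separated Ps D \<and> \<delta> > 0 \<longrightarrow>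
            (\<exists>x f. (\<forall>n. x n \<in> D) \<and> weak_star_summable sc Ps p f \<and>
                   (\<forall>n k. k < n \<longrightarrow> norm (f n (x k)) < \<delta>) \<and>
                   (\<forall>n. norm (f n (x n)) > 1 + \<delta>))))
  \<and> ((\<forall>A. p_infty_limited sc Ps p A \<longrightarrow> lc_precompact Ps A)
     \<longleftrightarrow> (\<forall>D. infinite D \<and> lc_bounded Ps D \<and> separated Ps D \<longrightarrow>
            (\<exists>T. coord_operator sc Ps p T \<and>
                 \<not> norm_precompact (if p = \<infinity> then sup_norm else l1_norm) (T ` D))))"
    (is "(?i \<longleftrightarrow> ?ii) \<and> (?i \<longleftrightarrow> ?iii) \<and> (?i \<longleftrightarrow> ?iv)")
proof -
  note K = assms(1) and lcs = assms(2)
  have "?ii" if "?i"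
  proof (intro allI impI, elim conjE)
    fix B assume "\<not> lc_precompact Ps B"
    \<comment> \<open>A limited set is nonempty by definition, so failure to be limited yields a
      witness sequence only after emptiness is excluded.\<close>
    moreover from this have "B \<noteq> {}" unfolding lc_precompact_def by auto
    ultimately show "\<exists>\<psi>. weak_star_summable sc Ps p \<psi> \<and> \<not> ((\<lambda>n. sup_on (\<psi> n) B) \<longlonglongrightarrow> 0)"
      using \<open>?i\<close> unfolding p_infty_limited_def by blast
  qed
  moreover have "?iii" if "?ii"
  proof (intro allI impI, elim conjE)
    fix D and \<delta> :: real
    assume D: "infinite D" "lc_bounded Ps D" "separated Ps D" and \<delta>: "\<delta> > 0"
    have "\<not> lc_precompact Ps D" by (rule infinite_separated_imp_not_precompact[OF lcs D(1,3)])
    then obtain \<psi> where \<psi>: "weak_star_summable sc Ps p \<psi>" "\<not> (\<lambda>n. sup_on (\<psi> n) D) \<longlonglongrightarrow> 0"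
      using \<open>?ii\<close> D(2) by blast
    show "\<exists>x f. (\<forall>n. x n \<in> D) \<and> weak_star_summable sc Ps p f \<and>
        (\<forall>n k. k < n \<longrightarrow> norm (f n (x k)) < \<delta>) \<and> (\<forall>n. norm (f n (x n)) > 1 + \<delta>)"
      by (rule summable_witness_imp_hump_sequence[OF lcs \<psi> \<delta>]) blast
  qed
  moreover have "?iv" if "?iii"
  proof (intro allI impI)
    fix D assume "infinite D \<and> lc_bounded Ps D \<and> separated Ps D"
    \<comment> \<open>The value 1 for \<delta> is arbitrary: the gap between \<delta> and 1 +
      \<delta> has length 1 in every case.\<close>
    then obtain x f where xf: "\<And>n. x n \<in> D" "weak_star_summable sc Ps p f"
      "\<And>n k. k < n \<Longrightarrow> norm (f n (x k)) < 1" "\<And>n. norm (f n (x n)) > 1 + 1"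
      using \<open>?iii\<close>[rule_format, of D 1] by auto
    have "coord_operator sc Ps p (\<lambda>x n. f n x)" by (rule coord_operatorI[OF lcs xf(2)])
    then show "\<exists>T. coord_operator sc Ps p T \<and>
        \<not> norm_precompact (if p = \<infinity> then sup_norm else l1_norm) (T ` D)"
      using hump_sequence_imp_not_norm_precompact[of sc Ps p "\<lambda>x n. f n x" x D 1] lcs xf by blast
  qed
  moreover have "?i" if "?iv"
  proof (intro allI impI, rule ccontr)
    fix A assume A: "p_infty_limited sc Ps p A" "\<not> lc_precompact Ps A"
    obtain D where D: "D \<subseteq> A" "infinite D" "separated Ps D"
      using not_precompact_imp_separated_subset[OF lcs A(2)] by blast
    have "lc_bounded Ps D"
      using p_infty_limited_imp_bounded[OF lcs K A(1)] D(1)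
      unfolding lc_bounded_def by (meson bdd_above_mono image_mono)
    then obtain T where "coord_operator sc Ps p T"
      "\<not> norm_precompact (if p = \<infinity> then sup_norm else l1_norm) (T ` D)"
      using \<open>?iv\<close> D by blast
    then show False using limited_imp_operator_image_precompact[OF lcs K A(1) D(1)] by blast
  qed
  ultimately show ?thesis by blast
qed

end
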